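(* Let $F$ be an algebraically closed field of characteristic zero, let $\mathbb Z_2=\{e,\sigma\}$, and let $A$ be a finite dimensional $\mathbb Z_2$-simple $F$-algebra with presentation $P_A=(H,\alpha,\mathfrak g)$ and with connected grading. Then $A$ is $\mathbb Z_2$-graded strongly verbally prime if and only if either $H\cong\mathbb Z_2$, or else $H=\{e\}$ and, up to the order of its entries, $\mathfrak g=(e,\ldots,e,\sigma,\ldots,\sigma)$ where $e$ and $\sigma$ have the same multiplicity.
   Context: Put $G=\mathbb Z_2$. $F\langle X_G\rangle$ is the free associative algebra on $X_G=\{x_{i,g}: i\in\mathbb N, g\in G\}$, $G$-graded by letting $x_{i_1,g_1}\cdots x_{i_n,g_n}$ have degree $g_1\cdots g_n$; a polynomial is $G$-homogeneous if it lies in one homogeneous component. For a $G$-graded algebra $A=\oplus_{g\in G}A_g$, $Id_G(A)$ is the set of polynomials vanishing under all substitutions of the variables $x_{i,g}$ by elements of $A_g$. $A$ (PI as an ungraded algebra) is $G$-graded strongly verbally prime if for any $G$-homogeneous $f,g$ defined on disjoint sets of variables with $fg\in Id_G(A)$, either $f\in Id_G(A)$ or $g\in Id_G(A)$. The grading is connected if $\{g\in G: A_g\neq0\}$ generates $G$. A $G$-graded algebra is $G$-simple if its multiplication is nonzero and it has no nontrivial $G$-graded two-sided ideals. For a subgroup $H\le G$, a 2-cocycle $c\in Z^2(H,F^* )$ (trivial action) and $\mathfrak g=(g_1,\ldots,g_m)\in G^m$, let $F^cH$ be the twisted group algebra with basis $\{u_h\}_{h\in H}$, $u_hu_{h'}=c(h,h')u_{hh'}$,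 and grade $F^cH\otimes M_m(F)$ by $A_g=\mathrm{span}_F\{u_h\otimes e_{i,j}: g=g_i^{-1}hg_j\}$. Every finite dimensional $G$-simple $F$-algebra is $G$-graded isomorphic to such an algebra (Bahturin–Sehgal–Zaicev), and one says that $P_A=(H,[c],\mathfrak g)$ is a presentation of $A$. *)

theory Defs
  imports "HOL-Algebra.Elementary_Groups" "HOL-Library.Poly_Mapping"
    "HOL-Computational_Algebra.Polynomial"
begin

section \<open>Free associative algebras\<close>

text \<open>The free monoid on \<open>'v\<close>, written additively: the type \<open>'v fword \<Rightarrow>\<^sub>0 'f\<close> is then its monoid
  algebra over \<open>'f\<close>, i.e. the free unital associative algebra on \<open>'v\<close>, with the library's
  ring structure of \<^theory>\<open>HOL-Library.Poly_Mapping\<close>.\<close>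

datatype 'v fword = FWord (letters: "'v list")

instantiation fword :: (type) monoid_add
begin

definition zero_fword :: "'a fword" where
  "0 = FWord []"

definition plus_fword :: "'a fword \<Rightarrow> 'a fword \<Rightarrow> 'a fword" where
  "u + v = FWord (letters u @ letters v)"

instance
  by standard (simp_all add: zero_fword_def plus_fword_def)

end

definition poly_vars :: "('v fword \<Rightarrow>\<^sub>0 'f::zero) \<Rightarrow> 'v set" where
  "poly_vars p = (\<Union>w\<in>Poly_Mapping.keys p. set (letters w))"


section \<open>Algebras and evaluation of polynomials\<close>

text \<open>Algebras are associative but not assumed unital.\<close>

locale assoc_algebra = vector_space scale
  for scale :: "'f::field \<Rightarrow> 'a::ring \<Rightarrow> 'a" +
  assumes scale_mult_left: "scale r x * y = scale r (x * y)"
    and scale_mult_right: "x * scale r y = scale r (x * y)"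

text \<open>The value of the empty monomial. It is only meaningful for unital algebras; every finite
  dimensional \<open>G\<close>-simple algebra is unital. The values of the other monomials do not involve it.\<close>

definition alg_unit :: "'a::ring" where
  "alg_unit = (THE u. \<forall>a. u * a = a \<and> a * u = a)"

fun word_value :: "('v \<Rightarrow> 'a::ring) \<Rightarrow> 'v list \<Rightarrow> 'a" where
  "word_value s [] = alg_unit"
| "word_value s [v] = s v"
| "word_value s (v # w # ws) = s v * word_value s (w # ws)"

definition poly_value ::
    "('f::field \<Rightarrow> 'a::ring \<Rightarrow> 'a) \<Rightarrow> ('v \<Rightarrow> 'a) \<Rightarrow> ('v fword \<Rightarrow>\<^sub>0 'f) \<Rightarrow> 'a" where
  "poly_value scale s p = (\<Sum>w\<in>Poly_Mapping.keys p.
     scale (Poly_Mapping.lookup p w) (word_value s (letters w)))"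

definition PI_algebra :: "('f::field \<Rightarrow> 'a::ring \<Rightarrow> 'a) \<Rightarrow> bool" where
  "PI_algebra scale \<longleftrightarrow> (\<exists>p :: nat fword \<Rightarrow>\<^sub>0 'f. p \<noteq> 0 \<and> (\<forall>s. poly_value scale s p = 0))"


section \<open>Graded algebras\<close>

text \<open>The last axiom says that the algebra is the direct sum of the components \<open>A g\<close>.\<close>

locale graded_algebra = group G + assoc_algebra scale
  for G :: "('g, 'm) monoid_scheme" (structure)
    and scale :: "'f::field \<Rightarrow> 'a::ring \<Rightarrow> 'a"
    and A :: "'g \<Rightarrow> 'a set" +
  assumes component_subspace: "g \<in> carrier G \<Longrightarrow> subspace (A g)"
    and component_mult:
      "\<lbrakk>g \<in> carrier G; h \<in> carrier G; a \<in> A g; b \<in> A h\<rbrakk> \<Longrightarrow> a * b \<in> A (g \<otimes> h)"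
    and direct_sum:
      "\<exists>!c. finite {g. c g \<noteq> 0} \<and> (\<forall>g\<in>carrier G. c g \<in> A g) \<and> (\<forall>g. g \<notin> carrier G \<longrightarrow> c g = 0)
          \<and> a = (\<Sum>g | c g \<noteq> 0. c g)"

definition finite_dimensional :: "('f::field \<Rightarrow> 'a::ab_group_add \<Rightarrow> 'a) \<Rightarrow> bool" where
  "finite_dimensional scale \<longleftrightarrow> (\<exists>B. finite_dimensional_vector_space scale B)"

definition graded_ideal ::
    "('g, 'm) monoid_scheme \<Rightarrow> ('f::field \<Rightarrow> 'a::ring \<Rightarrow> 'a) \<Rightarrow> ('g \<Rightarrow> 'a set) \<Rightarrow> 'a set \<Rightarrow> bool" where
  "graded_ideal G scale A I \<longleftrightarrow>
     module.subspace scale I \<and> (\<forall>a. \<forall>x\<in>I. a * x \<in> I \<and> x * a \<in> I) \<and>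
     I = module.span scale (\<Union>g\<in>carrier G. I \<inter> A g)"

definition graded_simple ::
    "('g, 'm) monoid_scheme \<Rightarrow> ('f::field \<Rightarrow> 'a::ring \<Rightarrow> 'a) \<Rightarrow> ('g \<Rightarrow> 'a set) \<Rightarrow> bool" where
  "graded_simple G scale A \<longleftrightarrow>
     (\<exists>a b :: 'a. a * b \<noteq> 0) \<and> (\<forall>I. graded_ideal G scale A I \<longrightarrow> I = {0} \<or> I = UNIV)"

definition connected_grading ::
    "('g, 'm) monoid_scheme \<Rightarrow> ('g \<Rightarrow> 'a::zero set) \<Rightarrow> bool" where
  "connected_grading G A \<longleftrightarrow> generate G {g \<in> carrier G. A g \<noteq> {0}} = carrier G"


section \<open>Graded polynomials and strongly verbally prime algebras\<close>

text \<open>The variable \<open>x\<^bsub>i,g\<^esub>\<close> is the pair \<open>(i, g)\<close>.\<close>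

definition graded_polys ::
    "('g, 'm) monoid_scheme \<Rightarrow> ((nat \<times> 'g) fword \<Rightarrow>\<^sub>0 'f::zero) set" where
  "graded_polys G = {p. poly_vars p \<subseteq> UNIV \<times> carrier G}"

definition word_degree :: "('g, 'm) monoid_scheme \<Rightarrow> (nat \<times> 'g) fword \<Rightarrow> 'g" where
  "word_degree G w = foldr (\<lambda>(i, g) d. g \<otimes>\<^bsub>G\<^esub> d) (letters w) \<one>\<^bsub>G\<^esub>"

definition homogeneous_poly ::
    "('g, 'm) monoid_scheme \<Rightarrow> ((nat \<times> 'g) fword \<Rightarrow>\<^sub>0 'f::zero) \<Rightarrow> bool" where
  "homogeneous_poly G p \<longleftrightarrow> (\<exists>g\<in>carrier G. \<forall>w\<in>Poly_Mapping.keys p. word_degree G w = g)"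

definition graded_identities ::
    "('g, 'm) monoid_scheme \<Rightarrow> ('f::field \<Rightarrow> 'a::ring \<Rightarrow> 'a) \<Rightarrow> ('g \<Rightarrow> 'a set) \<Rightarrow>
      ((nat \<times> 'g) fword \<Rightarrow>\<^sub>0 'f) set" where
  "graded_identities G scale A =
     {p \<in> graded_polys G.
        \<forall>s. (\<forall>i. \<forall>g\<in>carrier G. s (i, g) \<in> A g) \<longrightarrow> poly_value scale s p = 0}"

definition strongly_verbally_prime ::
    "('g, 'm) monoid_scheme \<Rightarrow> ('f::field \<Rightarrow> 'a::ring \<Rightarrow> 'a) \<Rightarrow> ('g \<Rightarrow> 'a set) \<Rightarrow> bool" where
  "strongly_verbally_prime G scale A \<longleftrightarrow>
     PI_algebra scale \<and>
     (\<forall>p\<in>graded_polys G. \<forall>q\<in>graded_polys G.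
        homogeneous_poly G p \<and> homogeneous_poly G q \<and> poly_vars p \<inter> poly_vars q = {} \<and>
        p * q \<in> graded_identities G scale A \<longrightarrow>
        p \<in> graded_identities G scale A \<or> q \<in> graded_identities G scale A)"


section \<open>Presentations\<close>

text \<open>Only the values of a cocycle on \<open>H \<times> H\<close> matter; a cohomology class contains all functions
  whose restriction to \<open>H \<times> H\<close> is cohomologous to the given one.\<close>

definition cocycle :: "('g, 'm) monoid_scheme \<Rightarrow> 'g set \<Rightarrow> ('g \<Rightarrow> 'g \<Rightarrow> 'f::field) \<Rightarrow> bool" where
  "cocycle G H c \<longleftrightarrow>
     (\<forall>h\<in>H. \<forall>h'\<in>H. c h h' \<noteq> 0) \<and>
     (\<forall>h\<in>H. \<forall>h'\<in>H. \<forall>h''\<in>H.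
        c h h' * c (h \<otimes>\<^bsub>G\<^esub> h') h'' = c h' h'' * c h (h' \<otimes>\<^bsub>G\<^esub> h''))"

definition cohomology_class ::
    "('g, 'm) monoid_scheme \<Rightarrow> 'g set \<Rightarrow> ('g \<Rightarrow> 'g \<Rightarrow> 'f::field) \<Rightarrow> ('g \<Rightarrow> 'g \<Rightarrow> 'f) set" where
  "cohomology_class G H c =
     {c'. cocycle G H c' \<and>
        (\<exists>b. (\<forall>h\<in>H. b h \<noteq> 0) \<and>
           (\<forall>h\<in>H. \<forall>h'\<in>H. c' h h' = c h h' * (b h * b h' / b (h \<otimes>\<^bsub>G\<^esub> h'))))}"

text \<open>Elements of \<open>F\<^sup>cH \<otimes> M\<^sub>m(F)\<close> are coordinate vectors: the coefficient of \<open>u\<^sub>h \<otimes> e\<^sub>i\<^sub>j\<close> sits at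
  \<open>(h, i, j)\<close>, with matrix indices \<open>i, j < m\<close>.\<close>

type_synonym ('g, 'f) tw_matrix = "('g \<times> nat \<times> nat) \<Rightarrow>\<^sub>0 'f"

definition tw_carrier :: "'g set \<Rightarrow> nat \<Rightarrow> ('g, 'f::field) tw_matrix set" where
  "tw_carrier H m = {x. Poly_Mapping.keys x \<subseteq> H \<times> {..<m} \<times> {..<m}}"

definition tw_scale :: "'f::field \<Rightarrow> ('g, 'f) tw_matrix \<Rightarrow> ('g, 'f) tw_matrix" where
  "tw_scale r x = Poly_Mapping.map ((*) r) x"

text \<open>Bilinear extension of
  \<open>(u\<^sub>h \<otimes> e\<^sub>i\<^sub>j) (u\<^bsub>h'\<^esub> \<otimes> e\<^sub>k\<^sub>l) = \<delta>\<^sub>j\<^sub>k c(h,h') u\<^bsub>hh'\<^esub> \<otimes> e\<^sub>i\<^sub>l\<close>.\<close>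

definition tw_mult ::
    "('g, 'm) monoid_scheme \<Rightarrow> ('g \<Rightarrow> 'g \<Rightarrow> 'f::field) \<Rightarrow>
      ('g, 'f) tw_matrix \<Rightarrow> ('g, 'f) tw_matrix \<Rightarrow> ('g, 'f) tw_matrix" where
  "tw_mult G c x y =
     (\<Sum>(h, i, j)\<in>Poly_Mapping.keys x. \<Sum>(h', k, l)\<in>Poly_Mapping.keys y.
        if j = k
        then Poly_Mapping.single (h \<otimes>\<^bsub>G\<^esub> h', i, l)
               (Poly_Mapping.lookup x (h, i, j) * Poly_Mapping.lookup y (h', k, l) * c h h')
        else 0)"

definition tw_component ::
    "('g, 'm) monoid_scheme \<Rightarrow> 'g set \<Rightarrow> 'g list \<Rightarrow> 'g \<Rightarrow> ('g, 'f::field) tw_matrix set" where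
  "tw_component G H gs g =
     {x \<in> tw_carrier H (length gs).
        \<forall>(h, i, j)\<in>Poly_Mapping.keys x. g = inv\<^bsub>G\<^esub> (gs ! i) \<otimes>\<^bsub>G\<^esub> h \<otimes>\<^bsub>G\<^esub> (gs ! j)}"

definition graded_iso_tw ::
    "('g, 'm) monoid_scheme \<Rightarrow> ('f::field \<Rightarrow> 'a::ring \<Rightarrow> 'a) \<Rightarrow> ('g \<Rightarrow> 'a set) \<Rightarrow>
      'g set \<Rightarrow> ('g \<Rightarrow> 'g \<Rightarrow> 'f) \<Rightarrow> 'g list \<Rightarrow> ('a \<Rightarrow> ('g, 'f) tw_matrix) \<Rightarrow> bool" where
  "graded_iso_tw G scale A H c gs \<phi> \<longleftrightarrow>
     bij_betw \<phi> UNIV (tw_carrier H (length gs)) \<and>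
     (\<forall>a b. \<phi> (a + b) = \<phi> a + \<phi> b) \<and>
     (\<forall>r a. \<phi> (scale r a) = tw_scale r (\<phi> a)) \<and>
     (\<forall>a b. \<phi> (a * b) = tw_mult G c (\<phi> a) (\<phi> b)) \<and>
     (\<forall>g\<in>carrier G. \<phi> ` A g = tw_component G H gs g)"

definition is_presentation ::
    "('g, 'm) monoid_scheme \<Rightarrow> ('f::field \<Rightarrow> 'a::ring \<Rightarrow> 'a) \<Rightarrow> ('g \<Rightarrow> 'a set) \<Rightarrow>
      'g set \<Rightarrow> ('g \<Rightarrow> 'g \<Rightarrow> 'f) set \<Rightarrow> 'g list \<Rightarrow> bool" where
  "is_presentation G scale A H \<alpha> gs \<longleftrightarrow>
     subgroup H G \<and> gs \<noteq> [] \<and> set gs \<subseteq> carrier G \<and>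
     (\<exists>c. cocycle G H c \<and> \<alpha> = cohomology_class G H c \<and>
        (\<exists>\<phi>. graded_iso_tw G scale A H c gs \<phi>))"

text \<open>As an additive group of residues, with \<open>e = 0\<close> and \<open>\<sigma> = 1\<close>.\<close>

abbreviation Z2 :: "int monoid" where
  "Z2 \<equiv> integer_mod_group 2"

end

theory Submission
  imports Defs "HOL-Combinatorics.Permutations"
begin

text \<open>The finite dimensional algebra \<open>A\<close> is treated through the basis \<open>u\<^sub>h \<otimes> e\<^sub>i\<^sub>j\<close> that its
  presentation provides.

  Sufficiency rests on homogeneous units. If every component of a graded simple algebra is
  spanned by units, then the algebra is strongly verbally prime
  (\<open>strongly_verbally_prime_if_spanned_by_units\<close>): from nonzero values \<open>P\<close> and \<open>Q\<close> of
  polynomials in disjoint variables one obtains \<open>P w Q w\<^sup>-\<^sup>1\<close> as a value of the product, for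
  every homogeneous unit \<open>w\<close>; if all of these vanish, then \<open>P A Q = 0\<close>, which graded
  simplicity forbids. The component of degree \<open>\<one>\<close> is always spanned by units, and each other
  component inherits this property as soon as it contains a single unit (\<open>span_units_one\<close>,
  \<open>span_homogeneous_units\<close>). If \<open>H\<close> is the whole group, the element \<open>u\<^sub>\<sigma> \<otimes> 1\<close> is such a unit
  of degree \<open>\<sigma>\<close>. If \<open>H\<close> is trivial and \<open>e\<close>, \<open>\<sigma>\<close> have the same multiplicity in the tuple \<open>gs\<close>,
  a permutation matrix that exchanges the two blocks is one (\<open>permutation_unit\<close>).

  For necessity, let \<open>H\<close> be trivial and let \<open>a > b\<close> be the multiplicities of the two group
  elements in \<open>gs\<close>. Connectedness gives \<open>b > 0\<close>. The component of degree \<open>e\<close> is \<open>M\<^sub>a \<times> M\<^sub>b\<close>,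
  and the component of degree \<open>\<sigma>\<close> consists of the off-diagonal blocks. A Capelli polynomial of
  length \<open>b\<^sup>2 + 1\<close> in variables of degree \<open>e\<close> vanishes on \<open>M\<^sub>b\<close>, which has dimension \<open>b\<^sup>2\<close>
  (\<open>capelli_vanishes\<close>), but not on \<open>M\<^sub>a\<close> (\<open>capelli_matrix_units\<close>). With two copies \<open>f\<close>, \<open>f'\<close>
  of it in disjoint variables and a further variable \<open>z\<close> of degree \<open>\<sigma>\<close>, the product of \<open>f\<close> and
  \<open>z f'\<close> is an identity, since the values of \<open>z\<close> have no entries in the block \<open>M\<^sub>a\<close>, while
  neither factor is (\<open>not_strongly_verbally_prime_if_unequal_blocks\<close>). The Capelli polynomials
  also show that \<open>A\<close> satisfies a polynomial identity in the ungraded sense.\<close>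

section \<open>Evaluating polynomials in a unital algebra\<close>

lemma poly_mapping_eq_sum_single:
  "p = (\<Sum>k\<in>Poly_Mapping.keys p. Poly_Mapping.single k (Poly_Mapping.lookup p k))"
  by (rule poly_mapping_eqI)
    (auto simp: lookup_sum lookup_single when_def in_keys_iff)

lemma word_value_map: "word_value s ws = word_value id (map s ws)"
  by (induction s ws rule: word_value.induct) auto

lemma word_value_cong:
  assumes "\<And>v. v \<in> set ws \<Longrightarrow> s v = t v"
  shows "word_value s ws = word_value t ws"
  using assms by (subst (1 2) word_value_map) (metis map_cong)

lemma poly_value_cong:
  assumes "\<And>v. v \<in> poly_vars p \<Longrightarrow> s v = t v"
  shows "poly_value scale s p = poly_value scale t p"
  unfolding poly_value_def
proof (rule sum.cong)
  fix w assume "w \<in> Poly_Mapping.keys p"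
  then have "word_value s (letters w) = word_value t (letters w)"
    using assms by (intro word_value_cong) (auto simp: poly_vars_def)
  then show "scale (Poly_Mapping.lookup p w) (word_value s (letters w)) =
      scale (Poly_Mapping.lookup p w) (word_value t (letters w))" by simp
qed simp

lemma letters_plus [simp]: "letters (u + v) = letters u @ letters v"
  by (simp add: plus_fword_def)

lemma poly_vars_mult: "poly_vars (p * q) \<subseteq> poly_vars p \<union> poly_vars q"
  using keys_mult[of p q] by (fastforce simp: poly_vars_def)

locale unital_assoc_algebra = assoc_algebra scale
  for scale :: "'f::field \<Rightarrow> 'a::ring \<Rightarrow> 'a" +
  fixes unit :: 'a
  assumes unit_left [simp]: "unit * a = a" and unit_right [simp]: "a * unit = a"
begin

lemma alg_unit_eq [simp]: "alg_unit = unit"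
  unfolding alg_unit_def by (rule the_equality) (simp, metis unit_left unit_right)

text \<open>Because of the unit, words of length one need no separate treatment.\<close>

lemma word_value_Cons [simp]:
  fixes s :: "'v \<Rightarrow> 'a"
  shows "word_value s (v # ws) = s v * word_value s ws"
  by (cases ws) auto

declare word_value.simps(2,3) [simp del]

lemma word_value_append:
  fixes s :: "'v \<Rightarrow> 'a"
  shows "word_value s (us @ ws) = word_value s us * word_value s ws"
  by (induction us) (auto simp: mult.assoc)

text \<open>Both inverse laws enter: \<open>w' w = 1\<close> cancels between neighbouring letters, and \<open>w w' = 1\<close> is
  the case of the empty word.\<close>

lemma word_value_conjugate:
  assumes "w * w' = unit" "w' * w = unit"
  shows "word_value (\<lambda>v. w * s v * w') ws = w * word_value s ws * w'"
proof (induction ws)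
  case (Cons v ws)
  have "w * s v * w' * (w * word_value s ws * w') = w * s v * (w' * w) * word_value s ws * w'"
    by (simp only: mult.assoc)
  with Cons show ?case by (simp add: assms mult.assoc)
qed (simp add: assms)

text \<open>An idempotent that commutes with all letters can be copied to every letter. It will be the
  projection onto a direct factor of the subalgebra generated by the letters.\<close>

lemma word_value_idempotent:
  fixes s :: "'v \<Rightarrow> 'a"
  assumes "e * e = e" and "\<And>v. v \<in> set ws \<Longrightarrow> e * s v = s v * e" and "ws \<noteq> []"
  shows "e * word_value s ws = word_value (\<lambda>v. e * s v) ws"
  using assms(2,3)
proof (induction ws)
  case (Cons v ws)
  show ?case
  proof (cases "ws = []")
    case False
    have "e * (s v * word_value s ws) = e * e * s v * word_value s ws"
      by (simp add: assms mult.assoc)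
    also have "\<dots> = e * (e * s v) * word_value s ws" by (simp only: mult.assoc)
    also have "e * s v = s v * e" using Cons.prems by simp
    also have "e * (s v * e) * word_value s ws = e * s v * (e * word_value s ws)"
      by (simp only: mult.assoc)
    finally show ?thesis using Cons False by simp
  qed (simp add: assms)
qed simp

lemma poly_value_superset:
  assumes "finite S" "Poly_Mapping.keys p \<subseteq> S"
  shows "poly_value scale s p = (\<Sum>w\<in>S. scale (Poly_Mapping.lookup p w) (word_value s (letters w)))"
  unfolding poly_value_def using assms
  by (intro sum.mono_neutral_left) (auto simp: in_keys_iff)

lemma poly_value_single [simp]:
  "poly_value scale s (Poly_Mapping.single w r) = scale r (word_value s (letters w))"
  by (subst poly_value_superset[of "{w}"]) auto

lemma poly_value_zero [simp]: "poly_value scale s 0 = 0"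
  by (simp add: poly_value_def)

lemma poly_value_add [simp]:
  "poly_value scale s (p + q) = poly_value scale s p + poly_value scale s q"
proof -
  let ?S = "Poly_Mapping.keys p \<union> Poly_Mapping.keys q"
  have "Poly_Mapping.keys (p + q) \<subseteq> ?S" by (rule keys_add)
  then show ?thesis
    by (simp add: poly_value_superset[of ?S] lookup_add scale_left_distrib sum.distrib)
qed

lemma poly_value_sum: "poly_value scale s (sum f I) = (\<Sum>i\<in>I. poly_value scale s (f i))"
  by (induction I rule: infinite_finite_induct) auto

lemma poly_value_mult:
  "poly_value scale s (p * q) = poly_value scale s p * poly_value scale s q"
proof -
  have "p * q = (\<Sum>u\<in>Poly_Mapping.keys p. \<Sum>v\<in>Poly_Mapping.keys q.
      Poly_Mapping.single (u + v) (Poly_Mapping.lookup p u * Poly_Mapping.lookup q v))"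
    by (subst poly_mapping_eq_sum_single[of p], subst poly_mapping_eq_sum_single[of q])
      (simp add: sum_product mult_single)
  then show ?thesis
    by (simp add: poly_value_sum word_value_append)
      (simp add: poly_value_def sum_product scale_mult_left scale_mult_right mult.commute)
qed

lemma poly_value_conjugate:
  assumes "w * w' = unit" "w' * w = unit"
  shows "poly_value scale (\<lambda>v. w * s v * w') p = w * poly_value scale s p * w'"
  by (simp add: poly_value_def word_value_conjugate[OF assms] sum_distrib_left sum_distrib_right
      scale_mult_left scale_mult_right)

text \<open>This form of the value makes linearity in a single letter evident; it gives the multilinearity
  of the Capelli polynomials below.\<close>

lemma word_value_linear_letter:
  fixes s :: "'v \<Rightarrow> 'a"
  assumes "count_list ws v = 1"
  obtains l r where "\<And>a. word_value (s(v := a)) ws = l * a * r"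
proof -
  have "v \<in> set ws" using assms by (metis count_list_0_iff zero_neq_one)
  then obtain us ws' where ws: "ws = us @ v # ws'" by (meson split_list)
  then have "count_list us v = 0" "count_list ws' v = 0" using assms by auto
  then have "v \<notin> set us" "v \<notin> set ws'" by (auto simp: count_list_0_iff)
  then have "word_value (s(v := a)) us = word_value s us"
    "word_value (s(v := a)) ws' = word_value s ws'" for a
    by (auto intro!: word_value_cong)
  then have "word_value (s(v := a)) ws = word_value s us * a * word_value s ws'" for a
    by (simp add: ws word_value_append mult.assoc)
  then show ?thesis using that by blast
qed

end

section \<open>Capelli polynomials\<close>

text \<open>The word \<open>x\<^sub>0 y\<^bsub>\<pi> 0\<^esub> x\<^sub>1 y\<^bsub>\<pi> 1\<^esub> \<dots> y\<^bsub>\<pi> (n - 1)\<^esub> x\<^sub>n\<close>. With the fixed letters \<open>x\<close> between the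
  permuted ones, the polynomial can detect every set of \<open>n\<close> linearly independent matrices of a
  matrix algebra.\<close>

primrec capelli_word :: "(nat \<Rightarrow> 'v) \<Rightarrow> (nat \<Rightarrow> 'v) \<Rightarrow> (nat \<Rightarrow> nat) \<Rightarrow> nat \<Rightarrow> 'v list" where
  "capelli_word x y \<pi> 0 = [x 0]"
| "capelli_word x y \<pi> (Suc n) = capelli_word x y \<pi> n @ [y (\<pi> n), x (Suc n)]"

definition capelli :: "(nat \<Rightarrow> 'v) \<Rightarrow> (nat \<Rightarrow> 'v) \<Rightarrow> nat \<Rightarrow> ('v fword \<Rightarrow>\<^sub>0 'f::field)" where
  "capelli x y n = (\<Sum>\<pi> | \<pi> permutes {..<n}.
     Poly_Mapping.single (FWord (capelli_word x y \<pi> n)) (of_int (sign \<pi>)))"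

lemma set_capelli_word: "set (capelli_word x y \<pi> n) = x ` {..n} \<union> y ` \<pi> ` {..<n}"
  by (induction n) (auto simp: lessThan_Suc atMost_Suc)

lemma capelli_word_neq_Nil [simp]: "capelli_word x y \<pi> n \<noteq> []"
  by (induction n) auto

lemma count_capelli_word:
  assumes "\<pi> permutes {..<n}" "inj y" "range x \<inter> range y = {}" "k < n"
  shows "count_list (capelli_word x y \<pi> n) (y k) = 1"
proof -
  have xy: "x i \<noteq> y j" for i j using assms(3) by blast
  have "count_list (capelli_word x y \<pi> m) (y k) = card {i. i < m \<and> \<pi> i = k}" for m
  proof (induction m)
    case (Suc m)
    have "{i. i < Suc m \<and> \<pi> i = k} =
        (if \<pi> m = k then insert m {i. i < m \<and> \<pi> i = k} else {i. i < m \<and> \<pi> i = k})"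
      by (auto simp: less_Suc_eq)
    then show ?case using Suc xy by (auto simp: inj_eq[OF assms(2)])
  qed (use xy in auto)
  moreover have "k \<in> \<pi> ` {..<n}" using permutes_image[OF assms(1)] assms(4) by simp
  then obtain j where "j < n" "\<pi> j = k" by blast
  then have "{i. i < n \<and> \<pi> i = k} = {j}"
    using permutes_inj[OF assms(1)] by (auto simp: inj_eq)
  ultimately show ?thesis by simp
qed

lemma capelli_word_eq_iff:
  assumes "inj y"
  shows "capelli_word x y \<pi> n = capelli_word x y \<rho> n \<longleftrightarrow> (\<forall>k<n. \<pi> k = \<rho> k)"
  by (induction n) (auto simp: less_Suc_eq inj_eq[OF assms])

lemma permutes_eq_id_iff:
  assumes "\<pi> permutes {..<n}"
  shows "(\<forall>k<n. \<pi> k = k) \<longleftrightarrow> \<pi> = id"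
proof
  assume "\<forall>k<n. \<pi> k = k"
  moreover have "\<pi> k = k" if "\<not> k < n" for k using assms that by (simp add: permutes_not_in)
  ultimately show "\<pi> = id" by (metis eq_id_iff)
qed simp

text \<open>Since distinct permutations give distinct words, no cancellation occurs in the coefficient of
  the word of the identity.\<close>

lemma capelli_neq_0:
  assumes "inj y"
  shows "capelli x y n \<noteq> (0 :: 'v fword \<Rightarrow>\<^sub>0 'f::field)"
proof -
  have "capelli_word x y \<pi> n = capelli_word x y id n \<longleftrightarrow> \<pi> = id" if "\<pi> permutes {..<n}" for \<pi>
    using permutes_eq_id_iff[OF that] by (simp add: capelli_word_eq_iff[OF assms])
  then have "Poly_Mapping.lookup (capelli x y n) (FWord (capelli_word x y id n)) =
      (\<Sum>\<pi> | \<pi> permutes {..<n}. if \<pi> = id then 1 else (0::'f))"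
    by (auto simp: capelli_def lookup_sum lookup_single when_def intro!: sum.cong)
  also have "\<dots> = 1"
    by (simp add: finite_permutations permutes_id)
  finally show ?thesis by auto
qed

lemma keys_capelli:
  "Poly_Mapping.keys (capelli x y n :: 'v fword \<Rightarrow>\<^sub>0 'f::field)
    \<subseteq> {FWord (capelli_word x y \<pi> n) | \<pi>. \<pi> permutes {..<n}}"
proof
  fix w assume "w \<in> Poly_Mapping.keys (capelli x y n :: 'v fword \<Rightarrow>\<^sub>0 'f)"
  then have "Poly_Mapping.lookup (capelli x y n) w \<noteq> (0::'f)" by (simp add: in_keys_iff)
  then obtain \<pi> where "\<pi> permutes {..<n}"
    "Poly_Mapping.lookup (Poly_Mapping.single (FWord (capelli_word x y \<pi> n)) (of_int (sign \<pi>))) w \<noteq> (0::'f)"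
    unfolding capelli_def lookup_sum by (metis (mono_tags, lifting) mem_Collect_eq sum.neutral)
  then show "w \<in> {FWord (capelli_word x y \<pi> n) | \<pi>. \<pi> permutes {..<n}}"
    by (auto simp: lookup_single when_def split: if_splits)
qed

lemma poly_vars_capelli:
  "poly_vars (capelli x y n :: 'v fword \<Rightarrow>\<^sub>0 'f::field) \<subseteq> range x \<union> range y"
  using keys_capelli[of x y n] by (fastforce simp: poly_vars_def set_capelli_word)

context unital_assoc_algebra
begin

lemma poly_value_capelli:
  "poly_value scale s (capelli x y n) =
    (\<Sum>\<pi> | \<pi> permutes {..<n}. scale (of_int (sign \<pi>)) (word_value s (capelli_word x y \<pi> n)))"
  by (simp add: capelli_def poly_value_sum)

text \<open>Composition of \<open>\<pi>\<close> with the transposition of \<open>i\<close> and \<open>j\<close> leaves the values of the words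
  unchanged and reverses the signs, so the value equals its negative.\<close>

lemma capelli_vanishes_equal_letters:
  assumes "(2::'f) \<noteq> 0" "i < n" "j < n" "i \<noteq> j" "s (y i) = s (y j)"
  shows "poly_value scale s (capelli x y n) = 0"
proof -
  let ?\<tau> = "Transposition.transpose i j"
  let ?D = "poly_value scale s (capelli x y n)"
  have \<tau>: "?\<tau> permutes {..<n}" by (rule permutes_swap_id) (use assms in auto)
  have sy: "s (y (?\<tau> k)) = s (y k)" for k
    using assms(5) by (simp add: Transposition.transpose_def)
  have same: "map s (capelli_word x y (?\<tau> \<circ> \<pi>) m) = map s (capelli_word x y \<pi> m)" for \<pi> m
    by (induction m) (auto simp: sy)
  have vals: "word_value s (capelli_word x y (?\<tau> \<circ> \<pi>) n) = word_value s (capelli_word x y \<pi> n)"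
    for \<pi> by (subst (1 2) word_value_map) (simp only: same)
  have sgn: "sign (?\<tau> \<circ> \<pi>) = - sign \<pi>" if "\<pi> permutes {..<n}" for \<pi>
    using that \<tau> assms(4)
    by (subst sign_compose) (auto simp: sign_swap_id intro: permutation_permutes[THEN iffD2])
  have "?D = (\<Sum>\<pi> | \<pi> permutes {..<n}.
      scale (of_int (sign (?\<tau> \<circ> \<pi>))) (word_value s (capelli_word x y (?\<tau> \<circ> \<pi>) n)))"
    unfolding poly_value_capelli by (rule setum_permutations_compose_left[OF \<tau>])
  also have "\<dots> = - ?D"
    unfolding poly_value_capelli sum_negf[symmetric]
    by (intro sum.cong) (simp_all add: sgn vals)
  finally have "?D + ?D = 0" by (metis add.left_inverse)
  then have "scale (1 + 1) ?D = 0" by (simp only: scale_left_distrib scale_one)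
  then show ?thesis using assms(1) by (simp only: scale_eq_0_iff one_add_one simp_thms)
qed

text \<open>The values of the letter \<open>y k\<close> at which the polynomial vanishes form a subspace, because of
  multilinearity, and the values of the other letters \<open>y j\<close> lie in it, because the polynomial
  alternates.\<close>

lemma capelli_vanishes_dependent_letters:
  assumes "(2::'f) \<noteq> 0" "inj y" "range x \<inter> range y = {}"
    and "k < n" "s (y k) \<in> span (s ` y ` ({..<n} - {k}))"
  shows "poly_value scale s (capelli x y n) = 0"
proof -
  let ?D = "\<lambda>a. poly_value scale (s(y k := a)) (capelli x y n)"
  have "\<exists>l r. \<forall>a. word_value (s(y k := a)) (capelli_word x y \<pi> n) = l * a * r"
    if "\<pi> permutes {..<n}" for \<pi>
    using word_value_linear_letter[OF count_capelli_word[OF that assms(2-4)]] by metis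
  then obtain l r where lr: "\<And>\<pi> a. \<pi> permutes {..<n} \<Longrightarrow>
      word_value (s(y k := a)) (capelli_word x y \<pi> n) = l \<pi> * a * r \<pi>" by metis
  have D: "?D a = (\<Sum>\<pi> | \<pi> permutes {..<n}. scale (of_int (sign \<pi>)) (l \<pi> * a * r \<pi>))" for a
    unfolding poly_value_capelli by (intro sum.cong) (auto simp: lr)
  have "subspace {a. ?D a = 0}"
  proof (rule subspaceI)
    fix a b c assume *: "a \<in> {a. ?D a = 0}"
    have "?D (scale c a) = scale c (?D a)"
      unfolding D by (simp add: scale_sum_right scale_mult_left scale_mult_right mult.commute)
    then show "scale c a \<in> {a. ?D a = 0}" using * by simp
    assume "b \<in> {a. ?D a = 0}"
    moreover have "?D (a + b) = ?D a + ?D b"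
      unfolding D by (simp add: distrib_left distrib_right scale_right_distrib sum.distrib)
    ultimately show "a + b \<in> {a. ?D a = 0}" using * by simp
  qed (simp add: D)
  moreover have "?D (s (y j)) = 0" if "j < n" "j \<noteq> k" for j
    by (rule capelli_vanishes_equal_letters[of j n k])
      (use assms that in \<open>auto simp: inj_eq\<close>)
  ultimately have "?D (s (y k)) = 0"
    using span_minimal[of "s ` y ` ({..<n} - {k})" "{a. ?D a = 0}"] assms(5) by blast
  then show ?thesis by simp
qed

text \<open>More values than the dimension of the space that contains them are repeated or linearly
  dependent, so the two preceding lemmas apply.\<close>

lemma capelli_vanishes:
  assumes "(2::'f) \<noteq> 0" "inj y" "range x \<inter> range y = {}"
    and "finite B" "card B < n" "\<And>k. s (y k) \<in> span B"
  shows "poly_value scale s (capelli x y n) = 0"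
proof (cases "inj_on (s \<circ> y) {..<n}")
  case True
  let ?S = "(s \<circ> y) ` {..<n}"
  have "?S \<subseteq> span B" using assms(6) by auto
  then have "dependent ?S"
    using independent_span_bound[of B ?S] assms(4,5) card_image[OF True] by auto
  then obtain k where k: "k < n" "s (y k) \<in> span (?S - {s (y k)})"
    by (auto simp: dependent_def)
  have "?S - {s (y k)} \<subseteq> s ` y ` ({..<n} - {k})" by auto
  from span_mono[OF this] k show ?thesis
    by (intro capelli_vanishes_dependent_letters[OF assms(1-3)]) auto
next
  case False
  then show ?thesis
    by (auto simp: inj_on_def intro: capelli_vanishes_equal_letters[OF assms(1)])
qed

lemma PI_algebra_if_finite_dimensional:
  assumes "(2::'f) \<noteq> 0" "finite_dimensional scale"
  shows "PI_algebra scale"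
proof -
  from assms(2) obtain B where "finite_dimensional_vector_space scale B"
    by (auto simp: finite_dimensional_def)
  then have B: "finite B" "span B = UNIV"
    by (auto simp: finite_dimensional_vector_space_def finite_dimensional_vector_space_axioms_def)
  \<comment> \<open>the letters \<open>x\<close> are the even variables and the letters \<open>y\<close> the odd ones\<close>
  have y: "inj (\<lambda>k::nat. 2 * k + 1)" by (auto simp: inj_def)
  have "range ((*) (2::nat)) \<inter> range (\<lambda>k. 2 * k + 1) = {}" by auto presburger
  then have "poly_value scale s (capelli ((*) 2) (\<lambda>k. 2 * k + 1) (Suc (card B))) = 0" for s
    using assms(1) B y by (intro capelli_vanishes) auto
  then show ?thesis unfolding PI_algebra_def using capelli_neq_0[OF y] by blast
qed

end

section \<open>Homogeneous units and primeness\<close>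

context graded_algebra
begin

lemma homogeneous_decomposition:
  obtains S c where "finite S" "S \<subseteq> carrier G" "\<And>g. g \<in> S \<Longrightarrow> c g \<in> A g" "a = sum c S"
proof -
  obtain c where "finite {g. c g \<noteq> 0}" "\<forall>g\<in>carrier G. c g \<in> A g"
    "\<forall>g. g \<notin> carrier G \<longrightarrow> c g = 0" "a = (\<Sum>g | c g \<noteq> 0. c g)"
    using direct_sum[of a] by blast
  then show ?thesis by (intro that[of "{g. c g \<noteq> 0}" c]) auto
qed

lemma homogeneous_independent:
  assumes "finite S" "S \<subseteq> carrier G" "\<And>g. g \<in> S \<Longrightarrow> f g \<in> A g" "sum f S = 0" "g \<in> S"
  shows "f g = 0"
proof -
  let ?dec = "\<lambda>c. finite {g. c g \<noteq> 0} \<and> (\<forall>g\<in>carrier G. c g \<in> A g) \<and>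
    (\<forall>g. g \<notin> carrier G \<longrightarrow> c g = 0) \<and> (0::'a) = (\<Sum>g | c g \<noteq> 0. c g)"
  let ?f = "\<lambda>g. if g \<in> S then f g else 0"
  have "(\<Sum>g | ?f g \<noteq> 0. ?f g) = sum f S"
    by (intro sum.mono_neutral_cong_left) (use assms(1) in auto)
  moreover have "finite {g. ?f g \<noteq> 0}" using assms(1) by (rule rev_finite_subset) auto
  ultimately have f: "?dec ?f"
    using assms(2-4) component_subspace subspace_0 by (auto split: if_splits)
  have zero: "?dec (\<lambda>_. 0)" using component_subspace subspace_0 by auto
  have ex: "\<exists>!c. ?dec c" by (rule direct_sum)
  have "?f = (\<lambda>_. 0)"
    using the1_equality[of ?dec, OF ex f] the1_equality[of ?dec, OF ex zero] by (rule trans[OF sym])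
  then show ?thesis using assms(5) by meson
qed

end

locale unital_graded_algebra = graded_algebra G scale A + unital_assoc_algebra scale unit
  for G :: "('g, 'm) monoid_scheme" (structure)
    and scale :: "'f::field \<Rightarrow> 'a::ring \<Rightarrow> 'a"
    and A :: "'g \<Rightarrow> 'a set"
    and unit :: 'a +
  assumes unit_component: "unit \<in> A \<one>"
begin

lemma word_value_component:
  assumes "\<And>i g. g \<in> carrier G \<Longrightarrow> s (i, g) \<in> A g" and "set ws \<subseteq> UNIV \<times> carrier G"
  shows "word_degree G (FWord ws) \<in> carrier G \<and> word_value s ws \<in> A (word_degree G (FWord ws))"
  using assms(2)
proof (induction ws)
  case Nil
  then show ?case by (simp add: word_degree_def unit_component)
next
  case (Cons v ws)
  obtain i g where "v = (i, g)" "g \<in> carrier G" using Cons.prems by auto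
  then show ?case
    using Cons component_mult[of g "word_degree G (FWord ws)" "s v" "word_value s ws"] assms(1)
    by (simp add: word_degree_def)
qed

lemma poly_value_component:
  assumes "p \<in> graded_polys G" "d \<in> carrier G"
    and "\<And>w. w \<in> Poly_Mapping.keys p \<Longrightarrow> word_degree G w = d"
    and "\<And>i g. g \<in> carrier G \<Longrightarrow> s (i, g) \<in> A g"
  shows "poly_value scale s p \<in> A d"
  unfolding poly_value_def
proof (intro subspace_sum subspace_scale component_subspace assms(2))
  fix w assume w: "w \<in> Poly_Mapping.keys p"
  then have "set (letters w) \<subseteq> UNIV \<times> carrier G"
    using assms(1) by (auto simp: graded_polys_def poly_vars_def)
  then show "word_value s (letters w) \<in> A d"
    using word_value_component[of s "letters w"] assms(4) assms(3)[OF w] by simp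
qed

text \<open>The elements \<open>x\<close> with \<open>p A x = 0\<close> form a two-sided ideal. It is graded because \<open>p\<close> is
  homogeneous, and so graded simplicity leaves only two possibilities for it.\<close>

lemma graded_prime:
  assumes "graded_simple G scale A" "d \<in> carrier G" "p \<in> A d" "\<And>a. p * a * q = 0"
  shows "p = 0 \<or> q = 0"
proof -
  define I where "I = {x. \<forall>a. p * a * x = 0}"
  have sub: "subspace I"
    by (intro subspaceI) (auto simp: I_def distrib_left scale_mult_right)
  have component_in_I: "c k \<in> I" if x: "sum c S \<in> I" and S: "finite S" "S \<subseteq> carrier G"
    and c: "\<And>g. g \<in> S \<Longrightarrow> c g \<in> A g" and k: "k \<in> S" for S c k
  proof -
    have hom: "p * a * c k = 0" if h: "h \<in> carrier G" "a \<in> A h" for a h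
    proof -
      let ?t = "d \<otimes> h"
      have t: "?t \<in> carrier G" using assms(2) h by simp
      have inv_t: "inv ?t \<otimes> (?t \<otimes> g) = g" if "g \<in> S" for g
        using that S(2) t by (simp add: m_assoc[symmetric] subset_iff)
      have inj: "inj_on ((\<otimes>) ?t) S"
        using inv_t by (metis inj_onI)
      \<comment> \<open>\<open>p a c\<^sub>k\<close> is the component of \<open>p a x\<close> in degree \<open>d h k\<close>; \<open>f\<close> is indexed by that degree\<close>
      define f where "f k = p * a * c (inv ?t \<otimes> k)" for k
      have f: "f (?t \<otimes> g) = p * a * c g" if "g \<in> S" for g
        using inv_t[OF that] by (simp add: f_def)
      have "sum f ((\<otimes>) ?t ` S) = p * a * sum c S"
        by (simp add: sum.reindex[OF inj] f sum_distrib_left)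
      also have "\<dots> = 0" using x by (simp add: I_def)
      finally have "f (?t \<otimes> k) = 0"
      proof (rule homogeneous_independent[rotated 3])
        show "(\<otimes>) ?t ` S \<subseteq> carrier G" using S t by auto
        fix g assume "g \<in> (\<otimes>) ?t ` S"
        then obtain k where "k \<in> S" "g = ?t \<otimes> k" by blast
        then show "f g \<in> A g"
          using f[of k] component_mult[OF t, of k "p * a" "c k"] c S(2)
            component_mult[OF assms(2) h(1) assms(3) h(2)] by auto
      qed (use S k in auto)
      then show ?thesis using f[OF k] by simp
    qed
    have "p * a * c k = 0" for a
    proof -
      obtain T b where "finite T" "T \<subseteq> carrier G" "\<And>g. g \<in> T \<Longrightarrow> b g \<in> A g" "a = sum b T"
        using homogeneous_decomposition[of a] by blast
      then show ?thesis
        using hom by (auto simp: sum_distrib_left sum_distrib_right intro!: sum.neutral)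
    qed
    then show ?thesis by (simp add: I_def)
  qed
  have "I \<subseteq> span (\<Union>g\<in>carrier G. I \<inter> A g)"
  proof
    fix x assume x: "x \<in> I"
    obtain S c where S: "finite S" "S \<subseteq> carrier G" "\<And>g. g \<in> S \<Longrightarrow> c g \<in> A g" and xc: "x = sum c S"
      using homogeneous_decomposition[of x] by blast
    have "c k \<in> I \<inter> A k" if "k \<in> S" for k
      using component_in_I[of c S k] x S that unfolding xc by blast
    then show "x \<in> span (\<Union>g\<in>carrier G. I \<inter> A g)"
      unfolding xc using S(2) by (intro span_sum span_base) blast
  qed
  moreover have "span (\<Union>g\<in>carrier G. I \<inter> A g) \<subseteq> I"
    by (rule span_minimal[OF _ sub]) auto
  moreover have "p * b * (a * x) = 0" "p * b * (x * a) = 0" if "x \<in> I" for a b x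
  proof -
    have "p * b * (a * x) = p * (b * a) * x" "p * b * (x * a) = p * b * x * a"
      by (simp_all only: mult.assoc)
    with that show "p * b * (a * x) = 0" "p * b * (x * a) = 0" by (simp_all add: I_def)
  qed
  ultimately have "graded_ideal G scale A I"
    unfolding graded_ideal_def using sub by (auto simp: I_def)
  then have "I = {0} \<or> I = UNIV" using assms(1) by (simp add: graded_simple_def)
  moreover have "q \<in> I" using assms(4) by (simp add: I_def)
  moreover have "p = 0" if "I = UNIV"
  proof -
    have "unit \<in> I" using that by simp
    then have "p * unit * unit = 0" unfolding I_def by blast
    then show ?thesis by simp
  qed
  ultimately show ?thesis by blast
qed

definition homogeneous_units :: "'g \<Rightarrow> 'a set" where
  "homogeneous_units g = {w \<in> A g. \<exists>w'\<in>A (inv g). w * w' = unit \<and> w' * w = unit}"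

text \<open>Right multiplication by a unit of degree \<open>g\<close> maps \<open>A \<one>\<close> onto \<open>A g\<close> and units to units.\<close>

lemma span_homogeneous_units:
  assumes "A \<one> \<subseteq> span (homogeneous_units \<one>)" "g \<in> carrier G" "homogeneous_units g \<noteq> {}"
  shows "A g \<subseteq> span (homogeneous_units g)"
proof
  fix x assume x: "x \<in> A g"
  obtain w w' where w: "w \<in> A g" "w' \<in> A (inv g)" "w * w' = unit" "w' * w = unit"
    using assms(3) by (auto simp: homogeneous_units_def)
  have "v * w \<in> homogeneous_units g" if hv: "v \<in> homogeneous_units \<one>" for v
  proof -
    obtain v' where v: "v \<in> A \<one>" "v' \<in> A \<one>" "v * v' = unit" "v' * v = unit"
      using hv by (auto simp: homogeneous_units_def)
    have "v * w * (w' * v') = v * (w * w') * v'" "w' * v' * (v * w) = w' * (v' * v) * w"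
      by (simp_all only: mult.assoc)
    moreover have "v * w \<in> A g" "w' * v' \<in> A (inv g)"
      using component_mult[of \<one> g v w] component_mult[of "inv g" \<one> w' v'] assms(2) v w by auto
    ultimately show ?thesis unfolding homogeneous_units_def using v w by auto
  qed
  then have "homogeneous_units \<one> \<subseteq> {y. y * w \<in> span (homogeneous_units g)}"
    by (auto intro: span_base)
  moreover have "subspace {y. y * w \<in> span (homogeneous_units g)}"
    by (rule subspaceI) (auto simp: distrib_right scale_mult_left span_add span_scale span_zero)
  ultimately have "span (homogeneous_units \<one>) \<subseteq> {y. y * w \<in> span (homogeneous_units g)}"
    by (rule span_minimal)
  moreover have "x * w' \<in> A \<one>"
    using component_mult[of g "inv g" x w'] assms(2) x w(2) by simp
  ultimately have "x * w' * w \<in> span (homogeneous_units g)" using assms(1) by blast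
  then show "x \<in> span (homogeneous_units g)" using w by (simp add: mult.assoc)
qed

text \<open>Let \<open>P\<close> and \<open>Q\<close> be nonzero values of \<open>p\<close> and \<open>q\<close>. The variables are disjoint, and in a
  commutative grading group conjugation by a homogeneous unit \<open>w\<close> preserves degrees, so \<open>P\<close>
  and \<open>w Q w\<^sup>-\<^sup>1\<close> are values of \<open>p\<close> and \<open>q\<close> under one admissible substitution. If \<open>p q\<close> is an
  identity, then \<open>P w Q = 0\<close> for all \<open>w\<close>, hence \<open>P A Q = 0\<close>, which contradicts graded
  primeness.\<close>

lemma strongly_verbally_prime_if_spanned_by_units:
  assumes "comm_group G" "PI_algebra scale" "graded_simple G scale A"
    and span_units: "\<And>g. g \<in> carrier G \<Longrightarrow> A g \<subseteq> span (homogeneous_units g)"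
  shows "strongly_verbally_prime G scale A"
  unfolding strongly_verbally_prime_def
proof (intro conjI ballI impI)
  interpret comm_group G by fact
  let ?graded = "\<lambda>s. \<forall>i. \<forall>g\<in>carrier G. s (i::nat, g) \<in> A g"
  fix p q :: "(nat \<times> 'g) fword \<Rightarrow>\<^sub>0 'f"
  assume p: "p \<in> graded_polys G" and q: "q \<in> graded_polys G"
  assume *: "homogeneous_poly G p \<and> homogeneous_poly G q \<and> poly_vars p \<inter> poly_vars q = {} \<and>
    p * q \<in> graded_identities G scale A"
  show "p \<in> graded_identities G scale A \<or> q \<in> graded_identities G scale A"
  proof (rule ccontr)
    assume "\<not> ?thesis"
    then obtain s t where s: "?graded s" "poly_value scale s p \<noteq> 0"
      and t: "?graded t" "poly_value scale t q \<noteq> 0"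
      using p q by (auto simp: graded_identities_def)
    let ?P = "poly_value scale s p" and ?Q = "poly_value scale t q"
    have unit: "?P * w * ?Q = 0" if g: "g \<in> carrier G" and w: "w \<in> homogeneous_units g" for g w
    proof -
      obtain w' where w: "w \<in> A g" "w' \<in> A (inv g)" "w * w' = unit" "w' * w = unit"
        using w by (auto simp: homogeneous_units_def)
      define r where "r v = (if v \<in> poly_vars p then s v else w * t v * w')" for v
      have "w * t (i, h) * w' \<in> A h" if h: "h \<in> carrier G" for i h
      proof -
        have "w * t (i, h) * w' \<in> A (g \<otimes> h \<otimes> inv g)"
          using g h t(1) w by (intro component_mult) auto
        also have "g \<otimes> h \<otimes> inv g = h" using g h by (simp add: m_comm[of g h] m_assoc)
        finally show ?thesis .
      qed
      then have "?graded r" using s(1) by (simp add: r_def)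
      then have "poly_value scale r (p * q) = 0" using * by (auto simp: graded_identities_def)
      moreover have "poly_value scale r p = ?P" by (rule poly_value_cong) (simp add: r_def)
      moreover have "poly_value scale r q = poly_value scale (\<lambda>v. w * t v * w') q"
        using * by (intro poly_value_cong) (auto simp: r_def)
      ultimately have "?P * (w * ?Q * w') = 0"
        by (simp add: poly_value_mult poly_value_conjugate[OF w(3,4)])
      then have "?P * (w * ?Q * w') * w = 0" by simp
      then show ?thesis using w(4) by (simp add: mult.assoc)
    qed
    have "?P * a * ?Q = 0" for a
    proof -
      obtain S c where S: "S \<subseteq> carrier G" "\<And>g. g \<in> S \<Longrightarrow> c g \<in> A g" "a = sum c S"
        using homogeneous_decomposition[of a] by blast
      have "subspace {a. ?P * a * ?Q = 0}"
        by (intro subspaceI)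
          (auto simp: distrib_left distrib_right scale_mult_left scale_mult_right)
      then have "span (homogeneous_units g) \<subseteq> {a. ?P * a * ?Q = 0}" if "g \<in> carrier G" for g
        using unit[OF that] by (intro span_minimal) auto
      then have "?P * c g * ?Q = 0" if "g \<in> S" for g
        using span_units S that by blast
      then show ?thesis by (simp add: S(3) sum_distrib_left sum_distrib_right)
    qed
    moreover obtain d where "d \<in> carrier G" "\<And>w. w \<in> Poly_Mapping.keys p \<Longrightarrow> word_degree G w = d"
      using * by (auto simp: homogeneous_poly_def)
    then have "d \<in> carrier G" "?P \<in> A d" using poly_value_component[OF p] s(1) by auto
    ultimately show False using graded_prime[OF assms(3)] s(2) t(2) by blast
  qed
qed fact

end

section \<open>Matrix units of a presented algebra\<close>

text \<open>The basis \<open>u\<^sub>h \<otimes> e\<^sub>i\<^sub>j\<close> of a presentation, transported to elements \<open>E h i j\<close> of the algebra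
  itself: there polynomials can be evaluated, whereas the coordinate vectors carry their
  product only as a separate operation.\<close>

locale twisted_matrix_algebra = graded_algebra G scale A
  for G :: "('g, 'm) monoid_scheme" (structure)
    and scale :: "'f::field \<Rightarrow> 'a::ring \<Rightarrow> 'a"
    and A :: "'g \<Rightarrow> 'a set" +
  fixes H :: "'g set" and c :: "'g \<Rightarrow> 'g \<Rightarrow> 'f" and gs :: "'g list"
    and E :: "'g \<Rightarrow> nat \<Rightarrow> nat \<Rightarrow> 'a"
  assumes H: "subgroup H G" and c: "cocycle G H c" and gs: "set gs \<subseteq> carrier G"
    and E_mult: "\<lbrakk>h \<in> H; h' \<in> H; i < length gs; j < length gs; k < length gs; l < length gs\<rbrakk> \<Longrightarrow>
      E h i j * E h' k l = (if j = k then scale (c h h') (E (h \<otimes> h') i l) else 0)"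
    and E_component: "\<lbrakk>h \<in> H; i < length gs; j < length gs\<rbrakk> \<Longrightarrow>
      E h i j \<in> A (inv (gs ! i) \<otimes> h \<otimes> gs ! j)"
    and E_neq_0: "\<lbrakk>h \<in> H; i < length gs; j < length gs\<rbrakk> \<Longrightarrow> E h i j \<noteq> 0"
    and component_span: "g \<in> carrier G \<Longrightarrow> A g \<subseteq> span {E h i j | h i j.
      h \<in> H \<and> i < length gs \<and> j < length gs \<and> inv (gs ! i) \<otimes> h \<otimes> gs ! j = g}"

lemma twisted_matrix_algebra_if_presentation:
  fixes G (structure) and scale :: "'f::field \<Rightarrow> 'a::ring \<Rightarrow> 'a"
  assumes "graded_algebra G scale A" "is_presentation G scale A H \<alpha> gs"
  obtains c E where "twisted_matrix_algebra G scale A H c gs E"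
proof -
  interpret graded_algebra G scale A by fact
  from assms(2) obtain c \<phi> where H: "subgroup H G" and gs: "set gs \<subseteq> carrier G"
    and c: "cocycle G H c" and \<phi>: "graded_iso_tw G scale A H c gs \<phi>"
    by (auto simp: is_presentation_def)
  let ?m = "length gs"
  have inj: "inj \<phi>" and range: "range \<phi> = tw_carrier H ?m"
    and add: "\<And>a b. \<phi> (a + b) = \<phi> a + \<phi> b"
    and scl: "\<And>r a. \<phi> (scale r a) = tw_scale r (\<phi> a)"
    and mult: "\<And>a b. \<phi> (a * b) = tw_mult G c (\<phi> a) (\<phi> b)"
    and comp: "\<And>g. g \<in> carrier G \<Longrightarrow> \<phi> ` A g = tw_component G H gs g"
    using \<phi> by (auto simp: graded_iso_tw_def bij_betw_def)
  have zero: "\<phi> 0 = 0" using add[of 0 0] by simp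
  have sum: "\<phi> (sum f S) = (\<Sum>x\<in>S. \<phi> (f x))" for f :: "'g \<times> nat \<times> nat \<Rightarrow> 'a" and S
    by (induction S rule: infinite_finite_induct) (auto simp: zero add)
  define E where "E h i j = inv_into UNIV \<phi> (Poly_Mapping.single (h, i, j) 1)" for h i j
  have \<phi>E: "\<phi> (E h i j) = Poly_Mapping.single (h, i, j) 1" if "h \<in> H" "i < ?m" "j < ?m" for h i j
  proof -
    have "Poly_Mapping.single (h, i, j) 1 \<in> range \<phi>"
      using that by (simp add: range tw_carrier_def)
    then show ?thesis by (simp add: E_def f_inv_into_f)
  qed
  have scale_E: "\<phi> (scale r (E h i j)) = Poly_Mapping.single (h, i, j) r"
    if "h \<in> H" "i < ?m" "j < ?m" for r h i j
    by (simp add: scl \<phi>E[OF that] tw_scale_def when_def)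
  have deg: "inv (gs ! i) \<otimes> h \<otimes> gs ! j \<in> carrier G" if "h \<in> H" "i < ?m" "j < ?m" for h i j
    using that gs subgroup.subset[OF H] by (auto dest!: nth_mem)
  have "twisted_matrix_algebra G scale A H c gs E"
  proof (intro twisted_matrix_algebra.intro twisted_matrix_algebra_axioms.intro)
    show "graded_algebra G scale A" "subgroup H G" "cocycle G H c" "set gs \<subseteq> carrier G" by fact+
  next
    fix h h' i j k l
    assume *: "h \<in> H" "h' \<in> H" "i < ?m" "j < ?m" "k < ?m" "l < ?m"
    then have hh: "h \<otimes> h' \<in> H" by (simp add: subgroup.m_closed[OF H])
    have "\<phi> (E h i j * E h' k l) =
        \<phi> (if j = k then scale (c h h') (E (h \<otimes> h') i l) else 0)"
      using * hh by (simp add: mult \<phi>E scale_E zero tw_mult_def)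
    then show "E h i j * E h' k l = (if j = k then scale (c h h') (E (h \<otimes> h') i l) else 0)"
      using inj by (simp only: inj_eq)
  next
    fix h i j assume *: "h \<in> H" "i < ?m" "j < ?m"
    have "\<phi> (E h i j) \<in> \<phi> ` A (inv (gs ! i) \<otimes> h \<otimes> gs ! j)"
      using * by (simp add: \<phi>E comp[OF deg] tw_component_def tw_carrier_def)
    then show "E h i j \<in> A (inv (gs ! i) \<otimes> h \<otimes> gs ! j)"
      using inj by (simp add: inj_image_mem_iff)
    have "\<phi> (E h i j) \<noteq> \<phi> 0"
      unfolding \<phi>E[OF *] zero by (metis lookup_single_eq lookup_zero zero_neq_one)
    then show "E h i j \<noteq> 0" by auto
  next
    fix g assume g: "g \<in> carrier G"
    show "A g \<subseteq> span {E h i j | h i j. h \<in> H \<and> i < ?m \<and> j < ?m \<and> inv (gs ! i) \<otimes> h \<otimes> gs ! j = g}"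
    proof
      fix x assume "x \<in> A g"
      then have x: "\<phi> x \<in> tw_component G H gs g" using comp[OF g] by blast
      let ?K = "Poly_Mapping.keys (\<phi> x)"
      have K: "h \<in> H \<and> i < ?m \<and> j < ?m \<and> inv (gs ! i) \<otimes> h \<otimes> gs ! j = g" if "(h, i, j) \<in> ?K" for h i j
        using x that by (auto simp: tw_component_def tw_carrier_def)
      let ?y = "\<Sum>k\<in>?K. scale (Poly_Mapping.lookup (\<phi> x) k) (case k of (h, i, j) \<Rightarrow> E h i j)"
      have "\<phi> ?y = (\<Sum>k\<in>?K. Poly_Mapping.single k (Poly_Mapping.lookup (\<phi> x) k))"
        unfolding sum using K by (intro sum.cong) (auto simp: scale_E)
      also have "\<dots> = \<phi> x" by (rule poly_mapping_eq_sum_single[symmetric])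
      finally have "x = ?y" using inj by (simp add: inj_eq)
      moreover have "?y \<in> span {E h i j | h i j.
          h \<in> H \<and> i < ?m \<and> j < ?m \<and> inv (gs ! i) \<otimes> h \<otimes> gs ! j = g}"
        using K by (intro span_sum span_scale span_base) fastforce
      ultimately show "x \<in> span {E h i j | h i j.
          h \<in> H \<and> i < ?m \<and> j < ?m \<and> inv (gs ! i) \<otimes> h \<otimes> gs ! j = g}" by metis
    qed
  qed
  then show ?thesis by (rule that)
qed

context twisted_matrix_algebra
begin

abbreviation m :: nat where "m \<equiv> length gs"

lemma H_simps [simp]:
  "\<one> \<in> H" "h \<in> H \<Longrightarrow> h \<in> carrier G" "\<lbrakk>h \<in> H; h' \<in> H\<rbrakk> \<Longrightarrow> h \<otimes> h' \<in> H" "h \<in> H \<Longrightarrow> inv h \<in> H"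
  using H by (auto simp: subgroup.one_closed subgroup.m_closed subgroup.m_inv_closed
      dest: subgroup.mem_carrier)

lemma gs_carrier [simp]: "i < m \<Longrightarrow> gs ! i \<in> carrier G"
  using gs nth_mem by blast

lemma c_neq_0 [simp]: "\<lbrakk>h \<in> H; h' \<in> H\<rbrakk> \<Longrightarrow> c h h' \<noteq> 0"
  using c by (simp add: cocycle_def)

lemma cocycle_law:
  "\<lbrakk>h \<in> H; h' \<in> H; h'' \<in> H\<rbrakk> \<Longrightarrow> c h h' * c (h \<otimes> h') h'' = c h' h'' * c h (h' \<otimes> h'')"
  using c unfolding cocycle_def by blast

lemma c_one_left: "h \<in> H \<Longrightarrow> c \<one> h = c \<one> \<one>"
  using cocycle_law[of \<one> \<one> h] by simp

lemma c_one_right: "h \<in> H \<Longrightarrow> c h \<one> = c \<one> \<one>"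
  using cocycle_law[of h \<one> \<one>] by simp

lemma c_inv: "h \<in> H \<Longrightarrow> c (inv h) h = c h (inv h)"
  using cocycle_law[of h "inv h" h] c_one_left[of h] c_one_right[of h] by simp

text \<open>The matrix unit \<open>1 \<otimes> e\<^sub>i\<^sub>j\<close>: the identity of a twisted group algebra is \<open>c(1,1)\<^sup>-\<^sup>1 u\<^sub>1\<close>.\<close>

definition U :: "nat \<Rightarrow> nat \<Rightarrow> 'a" where
  "U i j = scale (inverse (c \<one> \<one>)) (E \<one> i j)"

lemma U_mult_E: "\<lbrakk>h \<in> H; i < m; j < m; k < m; l < m\<rbrakk> \<Longrightarrow>
    U i j * E h k l = (if j = k then E h i l else 0)"
  by (simp add: U_def scale_mult_left E_mult c_one_left[of h])

lemma E_mult_U: "\<lbrakk>h \<in> H; i < m; j < m; k < m; l < m\<rbrakk> \<Longrightarrow>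
    E h i j * U k l = (if j = k then E h i l else 0)"
  by (simp add: U_def scale_mult_right E_mult c_one_right[of h])

lemma U_mult_U: "\<lbrakk>i < m; j < m; k < m; l < m\<rbrakk> \<Longrightarrow> U i j * U k l = (if j = k then U i l else 0)"
  by (simp add: U_def[of k l] U_def[of i l] scale_mult_right U_mult_E)

lemma U_neq_0: "\<lbrakk>i < m; j < m\<rbrakk> \<Longrightarrow> U i j \<noteq> 0"
  by (simp add: U_def E_neq_0)

lemma U_component: "\<lbrakk>i < m; j < m\<rbrakk> \<Longrightarrow> U i j \<in> A (inv (gs ! i) \<otimes> gs ! j)"
  unfolding U_def using E_component[of \<one> i j]
  by (intro subspace_scale component_subspace) auto

lemma span_E: "a \<in> span {E h i j | h i j. h \<in> H \<and> i < m \<and> j < m}"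
proof -
  obtain S b where S: "S \<subseteq> carrier G" "\<And>g. g \<in> S \<Longrightarrow> b g \<in> A g" "a = sum b S"
    using homogeneous_decomposition[of a] by blast
  have "A g \<subseteq> span {E h i j | h i j. h \<in> H \<and> i < m \<and> j < m}" if "g \<in> carrier G" for g
    using component_span[OF that] by (rule order_trans) (intro span_mono, auto)
  then show ?thesis unfolding S(3) using S(1,2) by (intro span_sum) blast
qed

definition one_A :: 'a where "one_A = (\<Sum>i<m. U i i)"

lemma one_A_left: "one_A * a = a"
proof -
  have "one_A * E h i j = E h i j" if "h \<in> H" "i < m" "j < m" for h i j
    using that by (simp add: one_A_def sum_distrib_right U_mult_E)
  moreover have "subspace {a. one_A * a = a}"
    by (rule subspaceI) (auto simp: distrib_left scale_mult_right)
  ultimately show ?thesis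
    using span_minimal[of "{E h i j | h i j. h \<in> H \<and> i < m \<and> j < m}" "{a. one_A * a = a}"] span_E[of a]
    by auto
qed

lemma one_A_right: "a * one_A = a"
proof -
  have "E h i j * one_A = E h i j" if "h \<in> H" "i < m" "j < m" for h i j
    using that by (simp add: one_A_def sum_distrib_left E_mult_U)
  moreover have "subspace {a. a * one_A = a}"
    by (rule subspaceI) (auto simp: distrib_right scale_mult_left)
  ultimately show ?thesis
    using span_minimal[of "{E h i j | h i j. h \<in> H \<and> i < m \<and> j < m}" "{a. a * one_A = a}"] span_E[of a]
    by auto
qed

lemma one_A_component: "one_A \<in> A \<one>"
  unfolding one_A_def using U_component[of i i for i]
  by (intro subspace_sum component_subspace) auto

end

sublocale twisted_matrix_algebra \<subseteq> unital_graded_algebra G scale A one_A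
  by standard (simp_all add: one_A_left one_A_right one_A_component)

context twisted_matrix_algebra
begin

text \<open>The hypotheses make \<open>1 + x\<close> a unit, and \<open>x = (1 + x) - 1\<close>.\<close>

lemma in_span_units_if_one_plus_unit:
  assumes "x \<in> A \<one>" "y \<in> A \<one>" "(one_A + x) * (one_A + y) = one_A" "(one_A + y) * (one_A + x) = one_A"
  shows "x \<in> span (homogeneous_units \<one>)"
proof -
  have "one_A + x \<in> A \<one>" "one_A + y \<in> A \<one>"
    using assms(1,2) one_A_component by (auto intro: subspace_add component_subspace)
  then have "one_A + x \<in> homogeneous_units \<one>" using assms(3,4) by (auto simp: homogeneous_units_def)
  moreover have "one_A \<in> homogeneous_units \<one>" by (auto simp: homogeneous_units_def one_A_component)
  ultimately have "one_A + x - one_A \<in> span (homogeneous_units \<one>)"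
    by (intro span_diff span_base)
  then show ?thesis by simp
qed

text \<open>A basis element of degree \<open>\<one>\<close> is of one of two kinds. If \<open>i \<noteq> j\<close>, its square is zero, and
  \<open>(1 + x) (1 - x) = 1\<close>. If \<open>i = j\<close>, it is a multiple of the idempotent \<open>e = 1 \<otimes> e\<^sub>i\<^sub>i\<close>, and
  \<open>(1 + e) (1 - e/2) = 1\<close>.\<close>

lemma span_units_one:
  assumes "(2::'f) \<noteq> 0"
  shows "A \<one> \<subseteq> span (homogeneous_units \<one>)"
proof -
  have "E h i j \<in> span (homogeneous_units \<one>)"
    if h: "h \<in> H" "i < m" "j < m" and d: "inv (gs ! i) \<otimes> h \<otimes> gs ! j = \<one>" for h i j
  proof (cases "i = j")
    case False
    have "E h i j \<in> A \<one>" using E_component[OF h] d by simp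
    moreover have "E h i j * E h i j = 0" using h False by (simp add: E_mult)
    ultimately show ?thesis
      by (intro in_span_units_if_one_plus_unit[of _ "- E h i j"])
        (auto simp: distrib_left distrib_right left_diff_distrib right_diff_distrib
          intro: subspace_neg component_subspace)
  next
    case True
    have "inv (gs ! i) \<otimes> h = inv (gs ! i)"
      using inv_equality[of "inv (gs ! i) \<otimes> h" "gs ! i"] d h True by simp
    then have "h = \<one>" using h by (simp add: l_cancel_one)
    have half: "inverse 2 + inverse 2 = (1::'f)" by (metis assms left_inverse mult_2_right)
    define y where "y = - scale (inverse 2) (U i i)"
    have U: "U i i \<in> A \<one>" using U_component[of i i] h by simp
    then have y: "y \<in> A \<one>"
      unfolding y_def by (intro subspace_neg subspace_scale component_subspace) auto
    have "scale (inverse 2) (U i i) + scale (inverse 2) (U i i) = U i i"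
      by (simp only: scale_left_distrib[symmetric] half scale_one)
    then have yy: "y + y = - U i i" unfolding y_def by (metis minus_add_distrib)
    have "U i i * y = y" "y * U i i = y"
      using h by (simp_all add: y_def scale_mult_left scale_mult_right U_mult_U)
    then have "(one_A + U i i) * (one_A + y) = one_A + (U i i + (y + y))"
      "(one_A + y) * (one_A + U i i) = one_A + (U i i + (y + y))"
      by (simp_all add: distrib_left distrib_right add.assoc add.commute add.left_commute)
    then have "U i i \<in> span (homogeneous_units \<one>)"
      unfolding yy by (intro in_span_units_if_one_plus_unit[OF U y]) simp_all
    then have "scale (c \<one> \<one>) (U i i) \<in> span (homogeneous_units \<one>)" by (rule span_scale)
    then show ?thesis using \<open>h = \<one>\<close> True by (simp add: U_def)
  qed
  then have "span {E h i j | h i j. h \<in> H \<and> i < m \<and> j < m \<and> inv (gs ! i) \<otimes> h \<otimes> gs ! j = \<one>}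
      \<subseteq> span (homogeneous_units \<one>)"
    by (intro span_minimal) auto
  then show ?thesis using component_span[of \<one>] by auto
qed

text \<open>The unit is \<open>u\<^sub>h\<close> times the permutation matrix of \<open>\<sigma>\<close>.\<close>

lemma permutation_unit:
  assumes "h \<in> H" "\<sigma> permutes {..<m}" "g \<in> carrier G"
    and deg: "\<And>i. i < m \<Longrightarrow> inv (gs ! i) \<otimes> h \<otimes> gs ! (\<sigma> i) = g"
  shows "homogeneous_units g \<noteq> {}"
proof -
  have \<sigma>: "\<sigma> i < m \<longleftrightarrow> i < m" "\<sigma> i = \<sigma> j \<longleftrightarrow> i = j" for i j
    using permutes_in_image[OF assms(2), of i] permutes_inj[OF assms(2)] by (auto simp: inj_eq)
  \<comment> \<open>\<open>r u\<^bsub>inv h\<^esub>\<close> is the inverse of \<open>u\<^sub>h\<close> in the twisted group algebra\<close>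
  define r where "r = inverse (c h (inv h) * c \<one> \<one>)"
  have r: "r * c h (inv h) = inverse (c \<one> \<one>)" using assms(1) by (simp add: r_def)
  let ?w = "\<Sum>i<m. E h i (\<sigma> i)" and ?w' = "\<Sum>i<m. scale r (E (inv h) (\<sigma> i) i)"
  have "?w * ?w' = (\<Sum>i<m. \<Sum>j<m. if i = j then U i i else 0)"
    unfolding sum_product using assms(1) \<sigma>
    by (intro sum.cong) (auto simp: scale_mult_right E_mult U_def r)
  also have "\<dots> = one_A" by (simp add: one_A_def)
  finally have w: "?w * ?w' = one_A" .
  have "?w' * ?w = (\<Sum>i<m. \<Sum>j<m. if i = j then U (\<sigma> i) (\<sigma> i) else 0)"
    unfolding sum_product using assms(1) \<sigma>
    by (intro sum.cong) (auto simp: scale_mult_left E_mult U_def c_inv[OF assms(1)] r)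
  also have "\<dots> = (\<Sum>i<m. U (\<sigma> i) (\<sigma> i))" by simp
  also have "\<dots> = one_A"
    unfolding one_A_def using sum.permute[OF assms(2), of "\<lambda>i. U i i"] by (simp add: comp_def)
  finally have w': "?w' * ?w = one_A" .
  have "E h i (\<sigma> i) \<in> A g" if "i < m" for i
    using E_component[of h i "\<sigma> i"] deg[OF that] that assms(1) \<sigma> by simp
  then have "?w \<in> A g" using assms(3) by (intro subspace_sum component_subspace) auto
  moreover have "?w' \<in> A (inv g)"
  proof (intro subspace_sum subspace_scale component_subspace)
    fix i assume "i \<in> {..<m}"
    then have i: "i < m" by simp
    have "inv (gs ! (\<sigma> i)) \<otimes> inv h \<otimes> gs ! i = inv (inv (gs ! i) \<otimes> h \<otimes> gs ! (\<sigma> i))"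
      using i assms(1) \<sigma> by (simp add: inv_mult_group m_assoc)
    then show "E (inv h) (\<sigma> i) i \<in> A (inv g)"
      using E_component[of "inv h" "\<sigma> i" i] assms(1) i \<sigma> deg by simp
  qed (use assms(3) in auto)
  ultimately show ?thesis using w w' by (auto simp: homogeneous_units_def)
qed

lemma strongly_verbally_prime_if_permutations:
  assumes "comm_group G" "PI_algebra scale" "graded_simple G scale A" "(2::'f) \<noteq> 0"
    and "\<And>g. g \<in> carrier G \<Longrightarrow> \<exists>h\<in>H. \<exists>\<sigma>. \<sigma> permutes {..<m} \<and>
      (\<forall>i<m. inv (gs ! i) \<otimes> h \<otimes> gs ! (\<sigma> i) = g)"
  shows "strongly_verbally_prime G scale A"
  using assms(1-3)
proof (rule strongly_verbally_prime_if_spanned_by_units)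
  fix g assume g: "g \<in> carrier G"
  from assms(5)[OF this] have "homogeneous_units g \<noteq> {}" using permutation_unit[OF _ _ g] by blast
  then show "A g \<subseteq> span (homogeneous_units g)"
    by (rule span_homogeneous_units[OF span_units_one[OF assms(4)] g])
qed

end

section \<open>Two blocks of different size\<close>

lemma word_degree_one:
  fixes G (structure)
  assumes "group G" "set ws \<subseteq> UNIV \<times> {\<one>}"
  shows "word_degree G (FWord ws) = \<one>"
proof -
  interpret group G by fact
  show ?thesis using assms(2) by (induction ws) (auto simp: word_degree_def)
qed

context twisted_matrix_algebra
begin

text \<open>Each \<open>x (Suc k)\<close> links the column of \<open>y k\<close> to the row of \<open>y (Suc k)\<close>, and the matrix units
  substituted for the \<open>y k\<close> are distinct, so only in the word of \<open>\<pi> = id\<close> do all neighbours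
  fit together.\<close>

lemma capelli_matrix_units:
  assumes "\<And>k. i k < m" "\<And>k. j k < m" "inj_on (\<lambda>k. (i k, j k)) {..<n}"
    and "s (x 0) = U (i 0) (i 0)" "\<And>k. s (x (Suc k)) = U (j k) (i (Suc k))"
    and "\<And>k. k < n \<Longrightarrow> s (y k) = U (i k) (j k)"
  shows "poly_value scale s (capelli x y n) = U (i 0) (i n)"
proof -
  have word: "word_value s (capelli_word x y \<pi> l) =
      (if \<forall>k<l. \<pi> k = k then U (i 0) (i l) else 0)" if "\<pi> permutes {..<n}" "l \<le> n" for \<pi> l
    using that(2)
  proof (induction l)
    case (Suc l)
    have l: "l < n" "\<pi> l < n" using Suc.prems permutes_in_image[OF that(1), of l] by auto
    have "\<pi> l = l \<longleftrightarrow> i l = i (\<pi> l) \<and> j (\<pi> l) = j l"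
      using inj_onD[OF assms(3), of "\<pi> l" l] l by auto
    then have "U (i 0) (i l) * (U (i (\<pi> l)) (j (\<pi> l)) * U (j l) (i (Suc l))) =
        (if \<pi> l = l then U (i 0) (i (Suc l)) else 0)"
      using assms(1,2) by (simp add: U_mult_U)
    then show ?case
      using Suc l assms(5,6) by (auto simp: word_value_append less_Suc_eq)
  qed (simp add: assms(4))
  have "poly_value scale s (capelli x y n) =
      (\<Sum>\<pi> | \<pi> permutes {..<n}. if \<pi> = id then U (i 0) (i n) else 0)"
    unfolding poly_value_capelli using word[of _ n]
    by (intro sum.cong) (auto simp: permutes_eq_id_iff)
  also have "\<dots> = U (i 0) (i n)" by (simp add: finite_permutations permutes_id)
  finally show ?thesis .
qed

text \<open>A block of size \<open>r\<close> has \<open>r\<^sup>2\<close> matrix units, all of degree \<open>\<one>\<close>, and \<open>n\<close> distinct ones among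
  them can be substituted for the letters \<open>y\<close>.\<close>

lemma capelli_nonzero_on_block:
  assumes "B \<subseteq> {..<m}" "\<And>i. i \<in> B \<Longrightarrow> gs ! i = g" "n \<le> card B * card B" "B \<noteq> {}"
    and "inj x" "inj y" "range x \<inter> range y = {}" "range x \<subseteq> UNIV \<times> {\<one>}" "range y \<subseteq> UNIV \<times> {\<one>}"
  obtains s i j where "\<And>k h. h \<in> carrier G \<Longrightarrow> s (k::nat, h) \<in> A h" "i \<in> B" "j \<in> B"
    "poly_value scale s (capelli x y n) = U i j"
proof -
  have fin: "finite B" using assms(1) finite_subset by blast
  then have "card {..<n} \<le> card (B \<times> B)" using assms(3) by (simp add: card_cartesian_product)
  then obtain f where f: "inj_on f {..<n}" "f ` {..<n} \<subseteq> B \<times> B"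
    using inj_on_iff_card_le[of "{..<n}" "B \<times> B"] fin by auto
  obtain b where b: "b \<in> B" using assms(4) by blast
  \<comment> \<open>beyond \<open>n\<close> any index of the block will do; the last letter \<open>x n\<close> uses the value \<open>i n\<close>\<close>
  define i where "i k = (if k < n then fst (f k) else b)" for k
  define j where "j k = (if k < n then snd (f k) else b)" for k
  have B: "i k \<in> B" "j k \<in> B" for k using f(2) b by (auto simp: i_def j_def image_subset_iff mem_Times_iff)
  then have m: "i k < m" "j k < m" for k using assms(1) by auto
  have inj: "inj_on (\<lambda>k. (i k, j k)) {..<n}" using f(1) by (auto simp: inj_on_def i_def j_def prod_eq_iff)
  define X where "X k = (case k of 0 \<Rightarrow> U (i 0) (i 0) | Suc k' \<Rightarrow> U (j k') (i k))" for k
  define s where "s v = (if v \<in> range x then X (inv_into UNIV x v)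
    else if v \<in> range y then U (i (inv_into UNIV y v)) (j (inv_into UNIV y v)) else 0)" for v
  have sx: "s (x k) = X k" for k using assms(5) by (simp add: s_def)
  have "y k \<notin> range x" for k using assms(7) by auto
  then have sy: "s (y k) = U (i k) (j k)" for k using assms(6) by (simp add: s_def)
  have U: "U i j \<in> A \<one>" if "i \<in> B" "j \<in> B" for i j
  proof -
    have "i < m" "j < m" using that assms(1) by auto
    then show ?thesis using U_component[of i j] assms(2)[OF that(1)] assms(2)[OF that(2)] gs_carrier[of i] by simp
  qed
  have "s (k, h) \<in> A h" if h: "h \<in> carrier G" for k h
  proof -
    have "X l \<in> A \<one>" for l unfolding X_def using U B by (cases l) auto
    moreover have "0 \<in> A h" using component_subspace[OF h] by (rule subspace_0)
    ultimately show ?thesis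
      unfolding s_def using assms(8,9) U B by auto
  qed
  moreover have "poly_value scale s (capelli x y n) = U (i 0) (i n)"
    by (rule capelli_matrix_units[where i = i and j = j]) (auto simp: m inj sx sy X_def)
  ultimately show ?thesis using that B by blast
qed

context
  assumes trivial: "H = {\<one>}"
begin

lemma component_span_U:
  assumes "g \<in> carrier G"
  shows "A g \<subseteq> span {U i j | i j. i < m \<and> j < m \<and> inv (gs ! i) \<otimes> gs ! j = g}" (is "_ \<subseteq> span ?S")
proof -
  have "E h i j \<in> span ?S"
    if "h \<in> H" "i < m" "j < m" "inv (gs ! i) \<otimes> h \<otimes> gs ! j = g" for h i j
  proof -
    have "U i j \<in> span ?S" using that trivial by (intro span_base) auto
    then have "scale (c \<one> \<one>) (U i j) \<in> span ?S" by (rule span_scale)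
    then show ?thesis using that(1) trivial by (simp add: U_def)
  qed
  then have "{E h i j | h i j. h \<in> H \<and> i < m \<and> j < m \<and> inv (gs ! i) \<otimes> h \<otimes> gs ! j = g} \<subseteq> span ?S"
    by blast
  from span_minimal[OF this subspace_span] show ?thesis using component_span[OF assms] by blast
qed

text \<open>If all entries of \<open>gs\<close> were equal, then every matrix unit would have degree \<open>\<one>\<close>, and so would
  the whole algebra.\<close>

lemma not_constant_if_connected:
  assumes "connected_grading G A" "carrier G \<noteq> {\<one>}"
  shows "\<exists>i<m. \<exists>j<m. gs ! i \<noteq> gs ! j"
proof (rule ccontr)
  assume const: "\<not> ?thesis"
  have "A g = {0}" if g: "g \<in> carrier G" "g \<noteq> \<one>" for g
  proof -
    have "inv (gs ! i) \<otimes> gs ! j \<noteq> g" if "i < m" "j < m" for i j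
    proof -
      have "gs ! i = gs ! j" using const that by blast
      then show ?thesis using g(2) that by simp
    qed
    then have empty: "{U i j | i j. i < m \<and> j < m \<and> inv (gs ! i) \<otimes> gs ! j = g} = {}" by blast
    have "A g \<subseteq> {0}" using component_span_U[OF g(1)] unfolding empty span_empty .
    then show ?thesis using component_subspace[OF g(1)] subspace_0 by blast
  qed
  then have "{g \<in> carrier G. A g \<noteq> {0}} \<subseteq> {\<one>}" by auto
  from mono_generate[OF this] have "carrier G \<subseteq> {\<one>}"
    using assms(1) by (simp add: connected_grading_def generate_one)
  then show False using assms(2) by auto
qed

definition block_unit :: "nat set \<Rightarrow> 'a" where
  "block_unit B = (\<Sum>i\<in>B. U i i)"

lemma block_unit_mult_U:
  assumes "B \<subseteq> {..<m}" "k < m" "l < m"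
  shows "block_unit B * U k l = (if k \<in> B then U k l else 0)"
proof -
  have "block_unit B * U k l = (\<Sum>i\<in>B. if i = k then U k l else 0)"
    unfolding block_unit_def sum_distrib_right using assms by (intro sum.cong) (auto simp: U_mult_U)
  also have "finite B" using assms(1) finite_subset by blast
  then have "(\<Sum>i\<in>B. if i = k then U k l else 0) = (if k \<in> B then U k l else 0)" by simp
  finally show ?thesis .
qed

lemma U_mult_block_unit:
  assumes "B \<subseteq> {..<m}" "k < m" "l < m"
  shows "U k l * block_unit B = (if l \<in> B then U k l else 0)"
proof -
  have "U k l * block_unit B = (\<Sum>i\<in>B. if i = l then U k l else 0)"
    unfolding block_unit_def sum_distrib_left using assms by (intro sum.cong) (auto simp: U_mult_U)
  also have "finite B" using assms(1) finite_subset by blast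
  then have "(\<Sum>i\<in>B. if i = l then U k l else 0) = (if l \<in> B then U k l else 0)" by simp
  finally show ?thesis .
qed

text \<open>Elements of degree \<open>\<one>\<close> are block diagonal, with one block for each value that occurs in \<open>gs\<close>.\<close>

lemma block_unit_central:
  assumes "B = {i. i < m \<and> gs ! i = g}" "a \<in> A \<one>"
  shows "block_unit B * a = a * block_unit B"
    and "block_unit B * a \<in> span ((\<lambda>(i, j). U i j) ` (B \<times> B))"
proof -
  have B: "B \<subseteq> {..<m}" using assms(1) by auto
  let ?S = "{U i j | i j. i < m \<and> j < m \<and> inv (gs ! i) \<otimes> gs ! j = \<one>}"
  have block: "k \<in> B \<longleftrightarrow> l \<in> B" if "k < m" "l < m" "inv (gs ! k) \<otimes> gs ! l = \<one>" for k l
  proof -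
    have "gs ! k = gs ! l" using that by (metis gs_carrier inv_equality inv_inv inv_closed)
    then show ?thesis using that assms(1) by simp
  qed
  have a: "a \<in> span ?S" using component_span_U[OF one_closed] assms(2) by blast
  have "subspace {a. block_unit B * a = a * block_unit B}"
    by (rule subspaceI) (auto simp: distrib_left distrib_right scale_mult_left scale_mult_right)
  moreover have "block_unit B * U k l = U k l * block_unit B"
    if "k < m" "l < m" "inv (gs ! k) \<otimes> gs ! l = \<one>" for k l
    using that block[OF that] by (simp only: block_unit_mult_U[OF B] U_mult_block_unit[OF B])
  then have "?S \<subseteq> {a. block_unit B * a = a * block_unit B}" by blast
  ultimately show "block_unit B * a = a * block_unit B" using a span_minimal by blast
  let ?T = "span ((\<lambda>(i, j). U i j) ` (B \<times> B))"
  have "subspace {a. block_unit B * a \<in> ?T}"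
    by (rule subspaceI) (auto simp: distrib_left scale_mult_right span_add span_scale span_zero)
  moreover have "block_unit B * U k l \<in> ?T"
    if "k < m" "l < m" "inv (gs ! k) \<otimes> gs ! l = \<one>" for k l
  proof (cases "k \<in> B")
    case True
    then have "l \<in> B" using block[OF that] by simp
    with True have "U k l \<in> ?T" by (intro span_base) auto
    then show ?thesis using that True by (simp add: block_unit_mult_U[OF B])
  qed (use that in \<open>simp add: block_unit_mult_U[OF B] span_zero\<close>)
  then have "?S \<subseteq> {a. block_unit B * a \<in> ?T}" by blast
  ultimately show "block_unit B * a \<in> ?T" using a span_minimal by blast
qed

text \<open>The component of degree \<open>\<one>\<close> is a direct product of matrix algebras, one for each block. The
  idempotent of a block projects onto one factor, and the Capelli polynomial vanishes there as
  soon as its length exceeds the dimension of the factor.\<close>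

lemma capelli_vanishes_on_block:
  assumes B: "B = {i. i < m \<and> gs ! i = g}" and "card B * card B < n" "(2::'f) \<noteq> 0"
    and xy: "inj y" "range x \<inter> range y = {}"
    and s: "\<And>k. s (x k) \<in> A \<one>" "\<And>k. s (y k) \<in> A \<one>"
  shows "block_unit B * poly_value scale s (capelli x y n) = 0"
    and "poly_value scale s (capelli x y n) * block_unit B = 0"
proof -
  let ?e = "block_unit B"
  have Bm: "B \<subseteq> {..<m}" and fin: "finite B" using B by auto
  have comm: "?e * s v = s v * ?e" if "v \<in> set (capelli_word x y \<pi> n)" for v \<pi>
    using that block_unit_central(1)[OF B] s by (auto simp: set_capelli_word)
  have "?e * (\<Sum>i\<in>B. U i i) = (\<Sum>i\<in>B. U i i)"
    unfolding sum_distrib_left using Bm by (intro sum.cong) (auto simp: block_unit_mult_U[OF Bm])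
  then have idem: "?e * ?e = ?e" unfolding block_unit_def[symmetric] .
  have comm_word: "word_value s ws * ?e = ?e * word_value s ws"
    if "\<And>v. v \<in> set ws \<Longrightarrow> ?e * s v = s v * ?e" for ws
    using that
  proof (induction ws)
    case (Cons v ws)
    have "s v * word_value s ws * ?e = s v * (word_value s ws * ?e)" by (simp only: mult.assoc)
    also have "word_value s ws * ?e = ?e * word_value s ws" using Cons by simp
    also have "s v * (?e * word_value s ws) = s v * ?e * word_value s ws" by (simp only: mult.assoc)
    also have "s v * ?e = ?e * s v" using Cons.prems[of v] by simp
    finally show ?case by (simp add: mult.assoc)
  qed simp
  have "?e * poly_value scale s (capelli x y n) =
      poly_value scale (\<lambda>v. ?e * s v) (capelli x y n)"
    using comm by (simp add: poly_value_capelli sum_distrib_left scale_mult_right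
        word_value_idempotent[OF idem])
  also have "\<dots> = 0"
  proof (rule capelli_vanishes[OF assms(3) xy])
    let ?T = "(\<lambda>(i, j). U i j) ` (B \<times> B)"
    show "finite ?T" using fin by simp
    have "card ?T \<le> card B * card B"
      using card_image_le[of "B \<times> B"] fin by (metis card_cartesian_product finite_cartesian_product)
    then show "card ?T < n" using assms(2) by simp
    show "?e * s (y k) \<in> span ?T" for k using block_unit_central(2)[OF B] s by blast
  qed
  finally show 0: "?e * poly_value scale s (capelli x y n) = 0" .
  have "poly_value scale s (capelli x y n) * ?e = ?e * poly_value scale s (capelli x y n)"
    using comm comm_word by (simp add: poly_value_capelli sum_distrib_left sum_distrib_right
        scale_mult_left scale_mult_right)
  with 0 show "poly_value scale s (capelli x y n) * ?e = 0" by simp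
qed

text \<open>Let \<open>e\<^sub>0\<close> and \<open>e\<^sub>1\<close> be the idempotents of the larger and of the smaller block, and let \<open>f\<close> be
  a Capelli polynomial in variables of degree \<open>\<one>\<close> that is one letter too long for the smaller
  block. Its values lie in \<open>e\<^sub>0 A e\<^sub>0\<close> and are not all zero. If \<open>f'\<close> is a copy of \<open>f\<close> in fresh
  variables and \<open>z\<close> is a variable of degree \<open>d = g\<^sub>1\<^sup>-\<^sup>1 g\<^sub>0 \<noteq> \<one>\<close>, then the values of \<open>f z f'\<close>
  lie in \<open>A (e\<^sub>0 A\<^sub>d e\<^sub>0) A\<close>, which is zero because the two diagonal blocks have degree \<open>\<one>\<close>.
  On the other hand \<open>z f'\<close> is not an identity: a matrix unit of degree \<open>d\<close>, from the smaller
  block to the larger one, can be multiplied by a nonzero value of \<open>f'\<close>.\<close>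

lemma not_strongly_verbally_prime_if_unequal_blocks:
  assumes "set gs \<subseteq> {g\<^sub>0, g\<^sub>1}" "g\<^sub>0 \<noteq> g\<^sub>1" "(2::'f) \<noteq> 0"
    and "0 < card {i. i < m \<and> gs ! i = g\<^sub>1}"
    and "card {i. i < m \<and> gs ! i = g\<^sub>1} < card {i. i < m \<and> gs ! i = g\<^sub>0}"
  shows "\<not> strongly_verbally_prime G scale A"
proof
  assume svp: "strongly_verbally_prime G scale A"
  define B\<^sub>0 where "B\<^sub>0 = {i. i < m \<and> gs ! i = g\<^sub>0}"
  define B\<^sub>1 where "B\<^sub>1 = {i. i < m \<and> gs ! i = g\<^sub>1}"
  have gs_cases: "gs ! i = g\<^sub>0 \<or> gs ! i = g\<^sub>1" if "i < m" for i
    using assms(1) nth_mem[OF that] by blast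
  have B: "B\<^sub>0 \<subseteq> {..<m}" "B\<^sub>1 \<subseteq> {..<m}" "{..<m} = B\<^sub>0 \<union> B\<^sub>1" "B\<^sub>0 \<inter> B\<^sub>1 = {}"
    using assms(2) gs_cases by (auto simp: B\<^sub>0_def B\<^sub>1_def)
  have fin: "finite B\<^sub>0" "finite B\<^sub>1" by (simp_all add: B\<^sub>0_def B\<^sub>1_def)
  have less: "0 < card B\<^sub>1" "card B\<^sub>1 < card B\<^sub>0"
    using assms(4,5) by (simp_all add: B\<^sub>0_def B\<^sub>1_def)
  then have ne: "B\<^sub>0 \<noteq> {}" "B\<^sub>1 \<noteq> {}" by auto
  then obtain i\<^sub>0 l where "i\<^sub>0 \<in> B\<^sub>0" and l: "l \<in> B\<^sub>1" by blast
  then have g: "g\<^sub>0 \<in> carrier G" "g\<^sub>1 \<in> carrier G" using gs_carrier by (auto simp: B\<^sub>0_def B\<^sub>1_def)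
  define n where "n = Suc (card B\<^sub>1 * card B\<^sub>1)"
  have n: "card B\<^sub>1 * card B\<^sub>1 < n" by (simp add: n_def)
  have n0: "n \<le> card B\<^sub>0 * card B\<^sub>0"
    unfolding n_def using less by (intro Suc_leI mult_strict_mono) auto
  define d where "d = inv g\<^sub>1 \<otimes> g\<^sub>0"
  have d: "d \<in> carrier G" "d \<noteq> \<one>"
    using g assms(2) by (auto simp: d_def) (metis inv_closed inv_equality inv_inv)
  \<comment> \<open>four disjoint families of variables of degree \<open>\<one>\<close>, separated by the residue of the index modulo 4\<close>
  define v where "v r k = (4 * k + r, \<one>)" for r k :: nat
  have v: "inj (v r)" "range (v r) \<subseteq> UNIV \<times> {\<one>}" for r by (auto simp: v_def inj_def)
  have v_disj: "range (v r) \<inter> range (v t) = {}" if "r < 4" "t < 4" "r \<noteq> t" for r t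
    using that by (auto simp: v_def) presburger
  let ?f = "\<lambda>r t. capelli (v r) (v t) n :: (nat \<times> 'g) fword \<Rightarrow>\<^sub>0 'f"
  let ?z = "(0::nat, d)"
  define p where "p = ?f 0 1"
  define q where "q = Poly_Mapping.single (FWord [?z]) 1 * ?f 2 3"
  have vG: "range (v r) \<subseteq> UNIV \<times> carrier G" for r by (auto simp: v_def)
  have z_vars: "?z \<notin> range (v r)" for r using d by (auto simp: v_def)
  have f_vars: "poly_vars (?f r t) \<subseteq> UNIV \<times> {\<one>}" for r t
    using poly_vars_capelli[of "v r" "v t" n] v(2) by blast
  have p_vars: "poly_vars p \<subseteq> range (v 0) \<union> range (v 1)"
    unfolding p_def by (rule poly_vars_capelli)
  let ?Z = "Poly_Mapping.single (FWord [?z]) (1::'f)"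
  have "poly_vars ?Z = {?z}" by (simp add: poly_vars_def)
  then have "poly_vars q \<subseteq> {?z} \<union> poly_vars (?f 2 3)"
    unfolding q_def using poly_vars_mult[of ?Z "?f 2 3"] by simp
  then have q_vars: "poly_vars q \<subseteq> {?z} \<union> (range (v 2) \<union> range (v 3))"
    using poly_vars_capelli[of "v 2" "v 3" n] by (rule order_trans[OF _ Un_mono[OF subset_refl]])
  have graded: "p \<in> graded_polys G" "q \<in> graded_polys G"
    unfolding graded_polys_def mem_Collect_eq
    using vG d(1) by (auto intro!: order_trans[OF p_vars] order_trans[OF q_vars])
  have f_deg: "word_degree G w = \<one>" if "w \<in> Poly_Mapping.keys (?f r t)" for w r t
    using that f_vars[of r t] word_degree_one[OF is_group, of "letters w"] by (auto simp: poly_vars_def)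
  have "word_degree G w = d" if "w \<in> Poly_Mapping.keys q" for w
  proof -
    have "w \<in> {a + b | a b. a \<in> {FWord [?z]} \<and> b \<in> Poly_Mapping.keys (?f 2 3)}"
      using that keys_mult[of ?Z "?f 2 3"] unfolding q_def by auto
    then obtain b where b: "w = FWord [?z] + b" "b \<in> Poly_Mapping.keys (?f 2 3)" by blast
    then have "word_degree G w = d \<otimes> word_degree G b"
      by (simp add: word_degree_def)
    then show ?thesis using f_deg[OF b(2)] d(1) by simp
  qed
  then have hom: "homogeneous_poly G p" "homogeneous_poly G q"
    using f_deg d(1) one_closed unfolding homogeneous_poly_def p_def by blast+
  have disj: "poly_vars p \<inter> poly_vars q = {}"
  proof -
    have ranges: "range (v 0) \<inter> range (v 2) = {}" "range (v 0) \<inter> range (v 3) = {}"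
      "range (v 1) \<inter> range (v 2) = {}" "range (v 1) \<inter> range (v 3) = {}"
      by (rule v_disj; simp)+
    have sets: "P \<inter> Q = {}"
      if "P \<subseteq> R\<^sub>0 \<union> R\<^sub>1" "Q \<subseteq> {z} \<union> (R\<^sub>2 \<union> R\<^sub>3)" "z \<notin> R\<^sub>0" "z \<notin> R\<^sub>1"
        "R\<^sub>0 \<inter> R\<^sub>2 = {}" "R\<^sub>0 \<inter> R\<^sub>3 = {}" "R\<^sub>1 \<inter> R\<^sub>2 = {}" "R\<^sub>1 \<inter> R\<^sub>3 = {}"
      for P Q R\<^sub>0 R\<^sub>1 R\<^sub>2 R\<^sub>3 :: "(nat \<times> 'g) set" and z
      using that by blast
    show ?thesis by (rule sets[OF p_vars q_vars z_vars z_vars ranges])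
  qed
  have q_value: "poly_value scale s q = s ?z * poly_value scale s (?f 2 3)" for s
    by (simp add: q_def poly_value_mult)
  have one: "one_A = block_unit B\<^sub>0 + block_unit B\<^sub>1"
    unfolding one_A_def block_unit_def B(3) using fin B(4) by (rule sum.union_disjoint)
  have "p * q \<in> graded_identities G scale A"
    unfolding graded_identities_def
  proof (intro CollectI conjI allI impI)
    show "p * q \<in> graded_polys G"
      using graded poly_vars_mult[of p q] by (auto simp: graded_polys_def)
    fix s :: "nat \<times> 'g \<Rightarrow> 'a" assume s: "\<forall>i. \<forall>g\<in>carrier G. s (i, g) \<in> A g"
    let ?P = "poly_value scale s p" and ?Q = "poly_value scale s (?f 2 3)"
    have sv: "s (v r k) \<in> A \<one>" for r k using s by (simp add: v_def)
    have "?P * block_unit B\<^sub>1 = 0" "block_unit B\<^sub>1 * ?Q = 0"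
      unfolding p_def
      by (rule capelli_vanishes_on_block[OF B\<^sub>1_def n assms(3) v(1)]; simp add: sv v_disj)+
    moreover have "?P * (block_unit B\<^sub>0 + block_unit B\<^sub>1) = ?P" "(block_unit B\<^sub>0 + block_unit B\<^sub>1) * ?Q = ?Q"
      unfolding one[symmetric] by simp_all
    ultimately have PQ: "?P * block_unit B\<^sub>0 = ?P" "block_unit B\<^sub>0 * ?Q = ?Q"
      by (simp_all add: distrib_left distrib_right)
    have "block_unit B\<^sub>0 * U i j * block_unit B\<^sub>0 = 0"
      if "i < m" "j < m" "inv (gs ! i) \<otimes> gs ! j = d" for i j
    proof (cases "i \<in> B\<^sub>0 \<and> j \<in> B\<^sub>0")
      case True
      then have "d = \<one>" using that g by (simp add: B\<^sub>0_def)
      then show ?thesis using d(2) by simp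
    qed (use that B(1) in \<open>auto simp: block_unit_mult_U U_mult_block_unit\<close>)
    moreover have "subspace {a. block_unit B\<^sub>0 * a * block_unit B\<^sub>0 = 0}"
      by (rule subspaceI) (auto simp: distrib_left distrib_right scale_mult_left scale_mult_right)
    ultimately have "span {U i j | i j. i < m \<and> j < m \<and> inv (gs ! i) \<otimes> gs ! j = d}
        \<subseteq> {a. block_unit B\<^sub>0 * a * block_unit B\<^sub>0 = 0}"
      by (intro span_minimal) auto
    moreover have "s ?z \<in> A d" using s d(1) by blast
    ultimately have 0: "block_unit B\<^sub>0 * s ?z * block_unit B\<^sub>0 = 0"
      using component_span_U[OF d(1)] by blast
    have "poly_value scale s (p * q) = (?P * block_unit B\<^sub>0) * (s ?z * (block_unit B\<^sub>0 * ?Q))"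
      by (simp only: PQ poly_value_mult q_value)
    also have "\<dots> = ?P * (block_unit B\<^sub>0 * s ?z * block_unit B\<^sub>0) * ?Q" by (simp only: mult.assoc)
    finally show "poly_value scale s (p * q) = 0" using 0 by simp
  qed
  then have "p \<in> graded_identities G scale A \<or> q \<in> graded_identities G scale A"
    using svp graded hom disj unfolding strongly_verbally_prime_def by blast
  moreover have f_nonzero: "\<exists>s i j. (\<forall>k. \<forall>h\<in>carrier G. s (k, h) \<in> A h) \<and> i \<in> B\<^sub>0 \<and> j \<in> B\<^sub>0 \<and>
      poly_value scale s (?f r t) = U i j" if rt: "r < 4" "t < 4" "r \<noteq> t" for r t
  proof -
    have block: "gs ! i = g\<^sub>0" if "i \<in> B\<^sub>0" for i using that by (simp add: B\<^sub>0_def)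
    obtain s i j where "\<And>k h. h \<in> carrier G \<Longrightarrow> s (k, h) \<in> A h" "i \<in> B\<^sub>0" "j \<in> B\<^sub>0"
      "poly_value scale s (?f r t) = U i j"
      by (rule capelli_nonzero_on_block[OF B(1) block n0 ne(1) v(1) v(1) v_disj[OF rt] v(2) v(2)])
        (assumption, rule that)
    then show ?thesis by blast
  qed
  have "p \<notin> graded_identities G scale A"
  proof -
    obtain s i j where s: "\<forall>k. \<forall>h\<in>carrier G. s (k, h) \<in> A h" and ij: "i \<in> B\<^sub>0" "j \<in> B\<^sub>0"
      and "poly_value scale s p = U i j" using f_nonzero[of 0 1] unfolding p_def by auto
    moreover have "i < m" "j < m" using ij B(1) by auto
    ultimately have "poly_value scale s p \<noteq> 0" by (simp add: U_neq_0)
    then show ?thesis using s by (auto simp: graded_identities_def)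
  qed
  moreover have "q \<notin> graded_identities G scale A"
  proof -
    obtain s i j where s: "\<forall>k. \<forall>h\<in>carrier G. s (k, h) \<in> A h" and ij: "i \<in> B\<^sub>0" "j \<in> B\<^sub>0"
      and f: "poly_value scale s (?f 2 3) = U i j" using f_nonzero[of 2 3] by auto
    have m: "i < m" "j < m" "l < m" using ij l B by auto
    let ?s = "s(?z := U l i)"
    have "U l i \<in> A d" using U_component[OF m(3,1)] ij l by (simp add: d_def B\<^sub>0_def B\<^sub>1_def)
    then have s': "\<forall>k. \<forall>h\<in>carrier G. ?s (k, h) \<in> A h" using s by auto
    have "poly_value scale ?s (?f 2 3) = poly_value scale s (?f 2 3)"
    proof (rule poly_value_cong)
      fix w assume "w \<in> poly_vars (?f 2 3)"
      then have "w \<noteq> ?z" using f_vars[of 2 3] d(2) by blast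
      then show "?s w = s w" by simp
    qed
    then have "poly_value scale ?s q = U l j" using m f by (simp add: q_value U_mult_U)
    then have "poly_value scale ?s q \<noteq> 0" using U_neq_0[OF m(3,2)] by simp
    then show ?thesis using s' unfolding graded_identities_def by blast
  qed
  ultimately show False by blast
qed

end

end

section \<open>Gradings by the group of two elements\<close>

lemma block_swapping_permutation:
  assumes "finite B" "finite C" "card B = card C" "B \<inter> C = {}"
  obtains \<sigma> where "\<sigma> permutes (B \<union> C)" "\<And>i. i \<in> B \<Longrightarrow> \<sigma> i \<in> C" "\<And>i. i \<in> C \<Longrightarrow> \<sigma> i \<in> B"
proof -
  obtain f where f: "bij_betw f B C" using finite_same_card_bij[OF assms(1-3)] by blast
  obtain f' where f': "bij_betw f' C B" using finite_same_card_bij[OF assms(2,1)] assms(3) by metis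
  define \<sigma> where "\<sigma> i = (if i \<in> B then f i else if i \<in> C then f' i else i)" for i
  have "bij_betw (\<lambda>i. if i \<in> B then f i else f' i) (B \<union> C) (C \<union> B)"
    using assms(4) by (intro bij_betw_disjoint_Un f f') auto
  then have "bij_betw \<sigma> (B \<union> C) (B \<union> C)"
    by (subst (asm) bij_betw_cong[of _ _ \<sigma>]) (auto simp: \<sigma>_def Un_commute)
  then have "\<sigma> permutes (B \<union> C)" by (rule bij_imp_permutes) (auto simp: \<sigma>_def)
  moreover have "\<sigma> i \<in> C" if "i \<in> B" for i using that bij_betwE[OF f] by (simp add: \<sigma>_def)
  moreover have "\<sigma> i \<in> B" if "i \<in> C" for i
    using that assms(4) bij_betwE[OF f'] by (auto simp: \<sigma>_def)
  ultimately show ?thesis using that by blast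
qed

lemma count_mset_eq_card_positions: "count (mset xs) x = card {i. i < length xs \<and> xs ! i = x}"
  by (simp add: count_mset count_list_eq_length_filter length_filter_conv_card eq_commute)

lemma carrier_Z2: "carrier Z2 = {0, 1}"
  by (auto simp: carrier_integer_mod_group)

lemma subgroup_Z2:
  assumes "subgroup H Z2"
  shows "H = {0} \<or> H = {0, 1}"
  using subgroup.subset[OF assms] subgroup.one_closed[OF assms] by (auto simp: carrier_Z2)

lemma iso_Z2_iff:
  assumes "subgroup H Z2"
  shows "Z2\<lparr>carrier := H\<rparr> \<cong> Z2 \<longleftrightarrow> H = {0, 1}"
proof
  assume "Z2\<lparr>carrier := H\<rparr> \<cong> Z2"
  then obtain f where "bij_betw f H {0, 1::int}" by (auto simp: is_iso_def iso_def carrier_Z2)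
  then have "card H = 2" using bij_betw_same_card by fastforce
  then show "H = {0, 1}" using subgroup_Z2[OF assms] by auto
next
  assume "H = {0, 1}"
  moreover have "{0..<2::int} = {0, 1}" by auto
  ultimately have "Z2\<lparr>carrier := H\<rparr> = Z2" by (simp add: integer_mod_group_def)
  then show "Z2\<lparr>carrier := H\<rparr> \<cong> Z2" by (simp add: iso_refl)
qed

theorem corollary1p11:
  fixes scale :: "'f::{alg_closed_field, field_char_0} \<Rightarrow> 'a::ring \<Rightarrow> 'a"
    and A :: "int \<Rightarrow> 'a set"
    and H :: "int set" and \<alpha> :: "(int \<Rightarrow> int \<Rightarrow> 'f) set" and gs :: "int list"
  assumes "graded_algebra Z2 scale A"
    and "finite_dimensional scale"
    and "graded_simple Z2 scale A"
    and "is_presentation Z2 scale A H \<alpha> gs"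
    and "connected_grading Z2 A"
  shows "strongly_verbally_prime Z2 scale A \<longleftrightarrow>
    (Z2\<lparr>carrier := H\<rparr> \<cong> Z2) \<or>
    (H = {0} \<and> (\<exists>k. mset gs = mset (replicate k 0 @ replicate k 1)))"
proof -
  obtain c E where "twisted_matrix_algebra Z2 scale A H c gs E"
    using twisted_matrix_algebra_if_presentation[OF assms(1,4)] by blast
  then interpret twisted_matrix_algebra Z2 scale A H c gs E .
  let ?B = "\<lambda>g. {i. i < m \<and> gs ! i = g}"
  have PI: "PI_algebra scale" using assms(2) by (intro PI_algebra_if_finite_dimensional) auto
  have H_cases: "H = {0} \<or> H = {0, 1}" by (rule subgroup_Z2[OF H])
  have iso_iff: "Z2\<lparr>carrier := H\<rparr> \<cong> Z2 \<longleftrightarrow> H = {0, 1}" by (rule iso_Z2_iff[OF H])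
  have gs01: "gs ! i = 0 \<or> gs ! i = 1" if "i < m" for i
    using gs_carrier[OF that] by (auto simp: carrier_Z2)
  show ?thesis
  proof (cases "H = {0, 1}")
    case True
    have "strongly_verbally_prime Z2 scale A"
    proof (rule strongly_verbally_prime_if_permutations[OF abelian_integer_mod_group PI assms(3)])
      \<comment> \<open>\<open>u\<^sub>g \<otimes> 1\<close> has degree \<open>g\<close>, because the grading group is commutative\<close>
      fix g assume g: "g \<in> carrier Z2"
      have "inv\<^bsub>Z2\<^esub> (gs ! i) \<otimes>\<^bsub>Z2\<^esub> g \<otimes>\<^bsub>Z2\<^esub> gs ! (id i) = g" if "i < m" for i
        using gs01[OF that] gs_carrier[OF that] g by (auto simp: carrier_Z2)
      then show "\<exists>h\<in>H. \<exists>\<sigma>. \<sigma> permutes {..<m} \<and>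
          (\<forall>i<m. inv\<^bsub>Z2\<^esub> (gs ! i) \<otimes>\<^bsub>Z2\<^esub> h \<otimes>\<^bsub>Z2\<^esub> gs ! (\<sigma> i) = g)"
        using g True carrier_Z2 permutes_id by blast
    qed simp
    then show ?thesis using True iso_iff by simp
  next
    case False
    then have H0: "H = {0}" using H_cases by simp
    have not_iso: "\<not> Z2\<lparr>carrier := H\<rparr> \<cong> Z2" using False iso_iff by simp
    have "strongly_verbally_prime Z2 scale A \<longleftrightarrow> card (?B 0) = card (?B 1)"
    proof
      assume eq: "card (?B 0) = card (?B 1)"
      \<comment> \<open>a permutation matrix has degree 1 if it exchanges the two blocks\<close>
      obtain \<tau> where "\<tau> permutes (?B 0 \<union> ?B 1)"
        and \<tau>: "\<And>i. i \<in> ?B 0 \<Longrightarrow> \<tau> i \<in> ?B 1" "\<And>i. i \<in> ?B 1 \<Longrightarrow> \<tau> i \<in> ?B 0"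
        using eq by (rule block_swapping_permutation[rotated 2]) auto
      moreover have "?B 0 \<union> ?B 1 = {..<m}" using gs01 by auto
      ultimately have \<tau>_perm: "\<tau> permutes {..<m}" by simp
      show "strongly_verbally_prime Z2 scale A"
      proof (rule strongly_verbally_prime_if_permutations[OF abelian_integer_mod_group PI assms(3)])
        fix g assume "g \<in> carrier Z2"
        then consider "g = 0" | "g = 1" by (auto simp: carrier_Z2)
        then show "\<exists>h\<in>H. \<exists>\<sigma>. \<sigma> permutes {..<m} \<and>
            (\<forall>i<m. inv\<^bsub>Z2\<^esub> (gs ! i) \<otimes>\<^bsub>Z2\<^esub> h \<otimes>\<^bsub>Z2\<^esub> gs ! (\<sigma> i) = g)"
        proof cases
          case 1
          have "inv\<^bsub>Z2\<^esub> (gs ! i) \<otimes>\<^bsub>Z2\<^esub> 0 \<otimes>\<^bsub>Z2\<^esub> gs ! (id i) = g" if "i < m" for i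
            using gs01[OF that] gs_carrier[OF that] 1 by auto
          then show ?thesis using permutes_id H0 by blast
        next
          case 2
          have "inv\<^bsub>Z2\<^esub> (gs ! i) \<otimes>\<^bsub>Z2\<^esub> 0 \<otimes>\<^bsub>Z2\<^esub> gs ! (\<tau> i) = g" if "i < m" for i
            using gs01[OF that] gs_carrier[OF that] \<tau>[of i] that 2 by auto
          then show ?thesis using \<tau>_perm H0 by blast
        qed
      qed simp
    next
      assume svp: "strongly_verbally_prime Z2 scale A"
      have H1: "H = {\<one>\<^bsub>Z2\<^esub>}" using H0 by simp
      have "carrier Z2 \<noteq> {\<one>\<^bsub>Z2\<^esub>}" by (simp add: carrier_Z2)
      then obtain i j where "i < m" "j < m" "gs ! i \<noteq> gs ! j"
        using not_constant_if_connected[OF H1 assms(5)] by blast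
      then have "?B 0 \<noteq> {}" "?B 1 \<noteq> {}" using gs01[of i] gs01[of j] by fastforce+
      then have pos: "0 < card (?B 0)" "0 < card (?B 1)" by (simp_all add: card_gt_0_iff)
      have "set gs \<subseteq> {0, 1}" "set gs \<subseteq> {1, 0}" using gs by (auto simp: carrier_Z2)
      with svp pos have "\<not> card (?B 1) < card (?B 0)" "\<not> card (?B 0) < card (?B 1)"
        using not_strongly_verbally_prime_if_unequal_blocks[OF H1, of 0 1]
          not_strongly_verbally_prime_if_unequal_blocks[OF H1, of 1 0] by auto
      then show "card (?B 0) = card (?B 1)" by simp
    qed
    also have "\<dots> \<longleftrightarrow> (\<exists>k. mset gs = mset (replicate k 0 @ replicate k 1))"
    proof
      assume eq: "card (?B 0) = card (?B 1)"
      have "count (mset gs) x = count (mset (replicate (card (?B 0)) 0 @ replicate (card (?B 0)) 1)) x" for x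
      proof -
        have "?B x = {}" if "x \<noteq> 0" "x \<noteq> 1" using gs01 that by auto
        then show ?thesis using eq by (auto simp: count_mset_eq_card_positions)
      qed
      then show "\<exists>k. mset gs = mset (replicate k 0 @ replicate k 1)" by (metis multiset_eqI)
    next
      assume "\<exists>k. mset gs = mset (replicate k 0 @ replicate k 1)"
      then obtain k where "mset gs = mset (replicate k 0 @ replicate k 1)" by blast
      then have "count (mset gs) 0 = k" "count (mset gs) 1 = k" by simp_all
      then show "card (?B 0) = card (?B 1)" by (simp add: count_mset_eq_card_positions)
    qed
    finally show ?thesis using not_iso H0 by blast
  qed
qed

end
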